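(* Let $q$ be any prime power. If $f$ is a uniformly random monic polynomial of degree $n$ in $\mathbb{F}_q[t]$, then with probability tending to $1$ as $n\to\infty$, \[\Delta(f)\ge(\log n)^{\zeta-o(1)},\] where $\zeta=\limsup_{k\to\infty}\frac{\log k}{\log(1/\beta_k)}$ and $o(1)\to0$ as $n\to\infty$.
   Context: For $f\in\mathbb{F}_q[t]$, $\Delta(f):=\max_r\#\{g\mid f:\ \deg(g)=r\}$. A logarithmic random set is a random $\mathbf{A}\subseteq\mathbb{N}$ with each $i$ included independently with probability $1/i$. For $k\ge2$, $\beta_k$ is the supremum of all $c<1$ such that, with probability tending to $1$ as $D\to\infty$, there exist distinct $A_1,\dots,A_k\subseteq\mathbf{A}\cap[D^c,D]$ with $\sum_{a\in A_1}a=\cdots=\sum_{a\in A_k}a$. *)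

theory Defs
  imports "HOL-Probability.Probability" "HOL-Computational_Algebra.Computational_Algebra"
begin

(* Divisors are not normalised to be monic; doing so would divide Delta f by the
   constant CARD('a) - 1.  For f \<noteq> 0 no divisor has degree above degree f. *)
definition Delta :: "'a::{finite,field} poly \<Rightarrow> nat" where
  "Delta f = (MAX r\<in>{..degree f}. card {g. g dvd f \<and> degree g = r})"

definition monic_polys :: "nat \<Rightarrow> 'a::{finite,field} poly set" where
  "monic_polys n = {f. degree f = n \<and> lead_coeff f = 1}"

definition log_space :: "(nat \<Rightarrow> bool) measure" where
  "log_space = PiM {1..} (\<lambda>i. measure_pmf (bernoulli_pmf (1 / real i)))"

definition log_set :: "(nat \<Rightarrow> bool) \<Rightarrow> nat set" where
  "log_set \<omega> = {i. 1 \<le> i \<and> \<omega> i}"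

definition equal_sums :: "nat \<Rightarrow> nat set \<Rightarrow> bool" where
  "equal_sums k S \<longleftrightarrow> (\<exists>A :: nat \<Rightarrow> nat set.
     inj_on A {1..k} \<and> (\<forall>i\<in>{1..k}. A i \<subseteq> S) \<and>
     (\<forall>i\<in>{1..k}. \<forall>j\<in>{1..k}. (\<Sum>a\<in>A i. a) = (\<Sum>a\<in>A j. a)))"

definition admissible :: "nat \<Rightarrow> real \<Rightarrow> bool" where
  "admissible k c \<longleftrightarrow>
     ((\<lambda>D::real. \<P>(\<omega> in log_space.
         equal_sums k (log_set \<omega> \<inter> {a. real a \<in> {D powr c..D}}))) \<longlongrightarrow> 1) at_top"

(* The real supremum of the empty set is unspecified; adjoining 0 makes it 0.
   This affects no other case, see beta_eq_Sup. *)
definition beta :: "nat \<Rightarrow> real" where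
  "beta k = Sup (insert 0 {c. c < 1 \<and> admissible k c})"

(* The limsup is taken in the extended reals so that its existence and finiteness
   need not be presupposed. *)
definition zeta :: ereal where
  "zeta = limsup (\<lambda>k. ereal (ln (real k) / ln (1 / beta k)))"

lemma finite_monic_polys: "finite (monic_polys n :: 'a::{finite,field} poly set)"
proof -
  have "monic_polys n \<subseteq> Poly ` {xs :: 'a list. set xs \<subseteq> UNIV \<and> length xs \<le> Suc n}"
  proof
    fix f :: "'a poly" assume "f \<in> monic_polys n"
    then have "length (coeffs f) \<le> Suc n"
      by (cases "f = 0") (auto simp: monic_polys_def length_coeffs)
    then show "f \<in> Poly ` {xs :: 'a list. set xs \<subseteq> UNIV \<and> length xs \<le> Suc n}"
      by (intro image_eqI[of _ _ "coeffs f"]) auto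
  qed
  then show ?thesis
    using finite_lists_length_le[of "UNIV :: 'a set" "Suc n"] finite_surj by auto
qed

lemma monic_polys_nonempty: "(monic_polys n :: 'a::{finite,field} poly set) \<noteq> {}"
proof -
  have "monom (1::'a) n \<in> monic_polys n"
    by (simp add: monic_polys_def degree_monom_eq)
  then show ?thesis by blast
qed

lemma equal_sums_event_measurable [measurable]:
  "Measurable.pred log_space
     (\<lambda>\<omega>. equal_sums k (log_set \<omega> \<inter> {a. real a \<in> {D powr c..D}}))"
proof -
  define F where "F = {a::nat. 1 \<le> a \<and> real a \<in> {D powr c..D}}"
  have "F \<subseteq> {..nat \<lfloor>D\<rfloor>}" by (auto simp: F_def le_nat_floor)
  then have fin: "finite F" by (rule finite_subset) simp
  have coord: "(\<lambda>\<omega>. \<omega> i) \<in> measurable log_space (count_space UNIV)" if "i \<in> F" for i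
  proof -
    have "(\<lambda>\<omega>. \<omega> i) \<in> measurable log_space (measure_pmf (bernoulli_pmf (1 / real i)))"
      unfolding log_space_def using that
      by (intro measurable_component_singleton) (auto simp: F_def)
    then show ?thesis by simp
  qed
  have "equal_sums k (log_set \<omega> \<inter> {a. real a \<in> {D powr c..D}}) \<longleftrightarrow>
      (\<exists>T\<in>{T \<in> Pow F. equal_sums k T}. \<forall>i\<in>F. \<omega> i = (i \<in> T))" for \<omega>
  proof -
    have eq: "log_set \<omega> \<inter> {a. real a \<in> {D powr c..D}} = {i\<in>F. \<omega> i}"
      by (auto simp: log_set_def F_def)
    have "T = {i\<in>F. \<omega> i}" if "T \<subseteq> F" "\<forall>i\<in>F. \<omega> i = (i \<in> T)" for T
      using that by auto
    moreover have "\<forall>i\<in>F. \<omega> i = (i \<in> {i\<in>F. \<omega> i})" by simp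
    ultimately show ?thesis unfolding eq
      by (smt (verit, best) Pow_iff mem_Collect_eq subsetI)
  qed
  moreover have "Measurable.pred log_space
      (\<lambda>\<omega>. \<exists>T\<in>{T \<in> Pow F. equal_sums k T}. \<forall>i\<in>F. \<omega> i = (i \<in> T))"
    using fin coord
    by (intro pred_intros_finite) auto
  ultimately show ?thesis by simp
qed

lemma beta_eq_Sup:
  assumes "c < 1" "admissible k c"
  shows "beta k = Sup {c. c < 1 \<and> admissible k c}"
proof (cases "c \<le> 0")
  case True
  have "log_set \<omega> \<inter> {a. real a \<in> {D powr c..D}} = log_set \<omega> \<inter> {a. real a \<in> {D powr 0..D}}"
    if "D \<ge> 1" for D \<omega>
  proof -
    have "D powr c \<le> D powr 0" using True that by (intro powr_mono) auto
    then have "D powr c \<le> 1" using that by simp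
    then show ?thesis using that by (auto simp: log_set_def)
  qed
  then have "\<forall>\<^sub>F D in at_top.
      \<P>(\<omega> in log_space. equal_sums k (log_set \<omega> \<inter> {a. real a \<in> {D powr c..D}})) =
      \<P>(\<omega> in log_space. equal_sums k (log_set \<omega> \<inter> {a. real a \<in> {D powr 0..D}}))"
    by (intro eventually_mono[OF eventually_ge_at_top[of 1]]) simp
  then have "admissible k 0"
    using assms(2) unfolding admissible_def by (rule Lim_transform_eventually[rotated])
  then show ?thesis unfolding beta_def by (simp add: insert_absorb)
next
  case False
  let ?S = "{c. c < 1 \<and> admissible k c}"
  have bdd: "bdd_above ?S" by (intro bdd_aboveI[of _ 1]) auto
  have "c \<le> Sup ?S" using assms bdd by (intro cSup_upper) auto
  moreover have "Sup (insert 0 ?S) = sup 0 (Sup ?S)"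
    using assms bdd by (intro cSup_insert) auto
  ultimately show ?thesis using False by (simp add: beta_def sup_real_def)
qed

end

theory Submission
  imports Defs "HOL-Real_Asymp.Real_Asymp"
begin

text \<open>
  The degrees \<open>d \<in> [D\<^sup>c, D]\<close> of the irreducible factors of a random \<open>f\<close> behave like a logarithmic
  random set as soon as \<open>D\<^sup>2 \<le> n\<close>. For a set \<open>U\<close> of monic irreducibles whose degrees add up to at
  most \<open>n\<close>, the probability that all of \<open>U\<close> divides \<open>f\<close> is exactly the product of the
  \<open>1 / q ^ degree p\<close> over \<open>p \<in> U\<close>, as if the factors were chosen independently; a truncated Moebius expansion
  then shows that all events have nearly the same probability as in the independent model. By the
  prime polynomial theorem that model produces a factor of degree \<open>d\<close> with probability
  \<open>1/d + O(1/d\<^sup>2)\<close>, independently in \<open>d\<close>.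

  Hence for admissible \<open>c\<close> almost every one of the roughly \<open>log log n / log (1/c)\<close> disjoint scales
  \<open>[D\<^sup>c, D]\<close> contains \<open>k\<close> sets of factor degrees with equal sums. Choosing one of the \<open>k\<close> sets in
  each scale independently gives \<open>k\<^sup>m\<close> divisors of the same degree, where \<open>m\<close> is the number of good
  scales, and \<open>k\<^sup>m\<close> is about \<open>(log n)\<close> to the power \<open>log k / log (1/c)\<close>.
\<close>

section \<open>Monic irreducible polynomials over a finite field\<close>

text \<open>Restricting to monic polynomials keeps one irreducible per associate class, so distinct
  elements are coprime.\<close>

definition irr :: "nat \<Rightarrow> 'a::{finite,field} poly set" where
  "irr d = {p. irreducible p \<and> lead_coeff p = 1 \<and> degree p = d}"

lemma monic_polys_Suc:
  "monic_polys (Suc n) = (\<lambda>(a, f). pCons a f) ` (UNIV \<times> (monic_polys n :: 'a::{finite,field} poly set))"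
proof (intro set_eqI iffI)
  fix f :: "'a poly"
  assume "f \<in> monic_polys (Suc n)"
  then have f: "degree f = Suc n" "lead_coeff f = 1" by (auto simp: monic_polys_def)
  obtain a g where g: "f = pCons a g" by (cases f)
  with f have "g \<noteq> 0" by auto
  with f g show "f \<in> (\<lambda>(a, f). pCons a f) ` (UNIV \<times> monic_polys n)"
    by (auto simp: monic_polys_def)
qed (auto simp: monic_polys_def)

lemma card_monic_polys: "card (monic_polys n :: 'a::{finite,field} poly set) = CARD('a) ^ n"
proof (induction n)
  case 0
  have "monic_polys 0 = {1 :: 'a poly}"
    by (auto simp: monic_polys_def elim!: degree_eq_zeroE)
  then show ?case by simp
next
  case (Suc n)
  have "inj_on (\<lambda>(a, f). pCons a f) (UNIV \<times> (monic_polys n :: 'a poly set))"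
    by (auto simp: inj_on_def)
  then show ?case
    unfolding monic_polys_Suc by (simp add: card_image card_cartesian_product Suc)
qed

lemma finite_irr [simp]: "finite (irr d :: 'a::{finite,field} poly set)"
  by (rule finite_subset[OF _ finite_monic_polys[of d]]) (auto simp: irr_def monic_polys_def)

text \<open>Cancelling \<open>g\<close> identifies these multiples with the monic polynomials of
  degree \<open>n - degree g\<close>.\<close>

lemma card_multiples:
  fixes g :: "'a::{finite,field} poly"
  assumes "lead_coeff g = 1" "degree g \<le> n"
  shows "card {f \<in> monic_polys n. g dvd f} = CARD('a) ^ (n - degree g)"
proof -
  have g0: "g \<noteq> 0" using assms by auto
  have "{f \<in> monic_polys n. g dvd f} = (*) g ` monic_polys (n - degree g)"
  proof (intro set_eqI iffI)
    fix f assume "f \<in> {f \<in> monic_polys n. g dvd f}"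
    then obtain h where h: "f = g * h" and f: "degree f = n" "lead_coeff f = 1"
      by (auto simp: monic_polys_def)
    then have "h \<noteq> 0" by auto
    have "lead_coeff h = 1" using f(2) assms(1) unfolding h by (metis lead_coeff_mult mult_1)
    moreover have "degree h = n - degree g" using f h g0 \<open>h \<noteq> 0\<close> by (simp add: degree_mult_eq)
    ultimately show "f \<in> (*) g ` monic_polys (n - degree g)"
      using h by (auto simp: monic_polys_def)
  next
    fix f assume "f \<in> (*) g ` monic_polys (n - degree g)"
    then obtain h where h: "f = g * h" and "h \<in> monic_polys (n - degree g)"
      by auto
    then have dh: "degree h = n - degree g" and lh: "lead_coeff h = 1"
      by (auto simp: monic_polys_def)
    then have "h \<noteq> 0" by auto
    then have "degree f = n" using h g0 assms dh by (simp add: degree_mult_eq)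
    moreover have "lead_coeff f = 1" using assms(1) lh unfolding h by (metis lead_coeff_mult mult_1)
    ultimately show "f \<in> {f \<in> monic_polys n. g dvd f}"
      using h by (simp add: monic_polys_def)
  qed
  moreover have "inj_on ((*) g) (monic_polys (n - degree g))"
    using g0 by (auto simp: inj_on_def)
  ultimately show ?thesis by (simp add: card_image card_monic_polys)
qed

lemma prob_dvd:
  fixes g :: "'a::{finite,field} poly"
  assumes "lead_coeff g = 1" "degree g \<le> n"
  shows "measure_pmf.prob (pmf_of_set (monic_polys n)) {f. g dvd f} = 1 / real CARD('a) ^ degree g"
proof -
  have "monic_polys n \<inter> {f. g dvd f} = {f \<in> monic_polys n. g dvd f}" by auto
  then show ?thesis
    using assms card_multiples[OF assms]
    by (simp add: measure_pmf_of_set finite_monic_polys monic_polys_nonempty card_monic_polys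
        field_simps flip: power_add of_nat_power of_nat_mult)
qed

lemma irr_prime_elem: "p \<in> irr d \<Longrightarrow> prime_elem p"
  by (simp add: irr_def field_poly_irreducible_imp_prime)

lemma irr_degree_pos: "p \<in> irr d \<Longrightarrow> d > 0"
  using is_unit_iff_degree[of p] by (auto simp: irr_def irreducible_def intro!: Nat.gr0I)

text \<open>The cofactor is a unit, hence a constant, and comparing leading coefficients forces it
  to be \<open>1\<close>.\<close>

lemma irr_dvd_irr:
  fixes p :: "'a::{finite,field} poly"
  assumes "p \<in> irr d" "p' \<in> irr e" "p dvd p'"
  shows "p = p'"
proof -
  obtain h where h: "p' = p * h" using assms by auto
  have "\<not> p dvd 1" using irr_prime_elem[OF assms(1)] by auto
  moreover have "irreducible p'" using assms by (simp add: irr_def)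
  ultimately have "h dvd 1" using h by (auto dest: irreducibleD)
  then obtain c where c: "h = [:c:]" by (auto elim!: is_unit_polyE)
  have "lead_coeff p' = lead_coeff p * c" unfolding h c by (subst lead_coeff_mult) simp
  then have "c = 1" using assms(1,2) by (auto simp: irr_def)
  then show ?thesis using h c by simp
qed

lemma irr_dvd_prod:
  assumes "p \<in> irr d" "finite U" "U \<subseteq> (\<Union>d. irr d)" "p dvd \<Prod>U"
  shows "p \<in> U"
proof -
  have "\<exists>p'\<in>U. p dvd p'"
    using assms(2) irr_prime_elem[OF assms(1)] assms(4)
  proof (induction U rule: finite_induct)
    case (insert a U)
    then show ?case using prime_elem_dvd_mult_iff[OF insert.prems(1), of a "\<Prod>U"] by auto
  qed auto
  then show ?thesis using irr_dvd_irr[OF assms(1)] assms(3) by fastforce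
qed

text \<open>Pairwise coprimality: the prime \<open>p\<close> does not divide the product of the
  other elements, so it must divide the cofactor of \<open>f\<close>.\<close>

lemma prod_irr_dvd_iff:
  fixes f :: "'a::{finite,field} poly"
  assumes "finite U" "U \<subseteq> (\<Union>d. irr d)"
  shows "\<Prod>U dvd f \<longleftrightarrow> (\<forall>p\<in>U. p dvd f)"
  using assms
proof (induction U rule: finite_induct)
  case (insert p U)
  then obtain d where d: "p \<in> irr d" by auto
  show ?case
  proof
    assume "\<Prod>(insert p U) dvd f"
    then show "\<forall>p\<in>insert p U. p dvd f"
      using insert by (metis dvd_mult_left dvd_mult_right insert_iff insert_subset prod.insert)
  next
    assume *: "\<forall>p\<in>insert p U. p dvd f"
    then obtain h where h: "f = \<Prod>U * h" using insert by auto
    have "\<not> p dvd \<Prod>U" using irr_dvd_prod[OF d] insert by auto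
    moreover have "p dvd \<Prod>U * h" using * h by auto
    ultimately have "p dvd h" using prime_elem_dvd_mult_iff[OF irr_prime_elem[OF d]] by blast
    then show "\<Prod>(insert p U) dvd f"
      using insert h by (simp add: mult.commute mult_dvd_mono)
  qed
qed auto

lemma lead_coeff_prod_irr:
  assumes "finite U" "U \<subseteq> (\<Union>d. irr d)"
  shows "lead_coeff (\<Prod>U) = 1"
  using assms by (induction U rule: finite_induct) (auto simp: irr_def lead_coeff_mult)

lemma degree_prod_irr:
  assumes "finite U" "U \<subseteq> (\<Union>d. irr d)"
  shows "degree (\<Prod>U) = (\<Sum>p\<in>U. degree p)"
  using degree_prod_eq_sum_degree[of U id] assms by (fastforce simp: irr_def irreducible_def)

text \<open>\<open>\<Prod>U\<close> is one monic divisor whose degree is the sum of the degrees, so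
  the exact count of its multiples factorises. Every later comparison with independence rests on
  this.\<close>

lemma prob_all_dvd:
  assumes "finite U" "U \<subseteq> (\<Union>d. irr d)" "(\<Sum>p\<in>U. degree p) \<le> n"
  shows "measure_pmf.prob (pmf_of_set (monic_polys n)) {f. \<forall>p\<in>U. p dvd (f :: 'a::{finite,field} poly)} =
    (\<Prod>p\<in>U. 1 / real CARD('a) ^ degree p)"
proof -
  have "{f. \<forall>p\<in>U. p dvd (f :: 'a poly)} = {f. \<Prod>U dvd f}" using prod_irr_dvd_iff[OF assms(1,2)] by auto
  then show ?thesis
    using prob_dvd[of "\<Prod>U" n] lead_coeff_prod_irr[OF assms(1,2)] assms(3)
    by (simp add: degree_prod_irr[OF assms(1,2)] prod_dividef power_sum)
qed

text \<open>Induction on the degree: an irreducible \<open>f\<close> is rescaled to be monic, a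
  reducible one has a factor of smaller positive degree.\<close>

lemma exists_irr_dvd:
  fixes f :: "'a::{finite,field} poly"
  assumes "degree f > 0"
  shows "\<exists>d. \<exists>p\<in>irr d. p dvd f"
  using assms
proof (induction "degree f" arbitrary: f rule: less_induct)
  case less
  have f0: "f \<noteq> 0" using less.prems by auto
  have nu: "\<not> f dvd 1" using less.prems by (auto simp: is_unit_iff_degree[OF f0])
  show ?case
  proof (cases "irreducible f")
    case True
    let ?p = "smult (inverse (lead_coeff f)) f"
    have "irreducible ?p"
    proof -
      have "?p = [:inverse (lead_coeff f):] * f" by simp
      moreover have "is_unit [:inverse (lead_coeff f):]" using f0 by (simp add: is_unit_pCons_iff)
      ultimately show ?thesis using True by (metis irreducible_mult_unit_left)
    qed
    then have "?p \<in> irr (degree f)" using f0 by (simp add: irr_def)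
    moreover have "?p dvd f" using f0 by (simp add: smult_dvd)
    ultimately show ?thesis by blast
  next
    case False
    then obtain a b where ab: "f = a * b" "\<not> a dvd 1" "\<not> b dvd 1"
      using f0 nu by (auto simp: irreducible_def)
    have nz: "a \<noteq> 0" "b \<noteq> 0" using ab f0 by auto
    have "degree a > 0" "degree b > 0" using ab nz 
      by (auto simp: is_unit_iff_degree)
    then have "\<exists>d. \<exists>p\<in>irr d. p dvd a"
      using less.hyps[of a] ab nz by (simp add: degree_mult_eq)
    then show ?thesis using ab by (meson dvd_mult2)
  qed
qed

section \<open>The prime polynomial theorem\<close>

definition primes_upto :: "nat \<Rightarrow> 'a::{finite,field} poly set" where
  "primes_upto n = (\<Union>d\<in>{1..n}. irr d)"

text \<open>Counting prime powers dividing \<open>f\<close>, weighted by the degree of the prime, gives the degree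
  of \<open>f\<close>; averaging this over all monic \<open>f\<close> yields the prime polynomial theorem.\<close>
lemma degree_eq_sum_prime_powers:
  fixes f :: "'a::{finite,field} poly"
  assumes "lead_coeff f = 1" "degree f \<le> n"
  shows "degree f = (\<Sum>(p, j)\<in>{(p, j). p \<in> primes_upto n \<and> j \<in> {1..n} \<and> p ^ j dvd f}. degree p)"
  using assms
proof (induction "degree f" arbitrary: f rule: less_induct)
  case (less f)
  \<comment> \<open>The cutoff \<open>n\<close> stays fixed while the degree of \<open>f\<close>
    drops, so the index sets of \<open>f\<close> and of its cofactor are cut from the same finite
    product.\<close>
  let ?A = "\<lambda>f. {(p, j). p \<in> primes_upto n \<and> j \<in> {1..n} \<and> p ^ j dvd (f :: 'a poly)}"
  have fin: "finite (?A f)" for f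
    by (rule finite_subset[of _ "primes_upto n \<times> {1..n}"]) (auto simp: primes_upto_def)
  have irrd: "\<exists>d. p \<in> irr d \<and> degree p = d \<and> 1 \<le> d \<and> d \<le> n" if "p \<in> primes_upto n" for p :: "'a poly"
    using that by (auto simp: primes_upto_def) (auto simp: irr_def)
  show ?case
  proof (cases "degree f = 0")
    case True
    then have "f = 1" using less.prems by (auto elim!: degree_eq_zeroE)
    have "\<not> p ^ j dvd 1" if "p \<in> primes_upto n" "j \<in> {1..n}" for p :: "'a poly" and j
      using that irrd[OF that(1)] irr_prime_elem[of p "degree p"] by (auto simp: is_unit_power_iff)
    then have "?A f = {}" using \<open>f = 1\<close> by auto
    then show ?thesis using True by (simp only: sum.empty)
  next
    case False
    then obtain d p0 where p0: "p0 \<in> irr d" "p0 dvd f" using exists_irr_dvd by blast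
    then obtain g where g: "f = p0 * g" by auto
    have nz: "f \<noteq> 0" "g \<noteq> 0" "p0 \<noteq> 0" using False g by auto
    have dp0: "degree p0 = d" "d > 0" "lead_coeff p0 = 1" using p0 irr_degree_pos by (auto simp: irr_def)
    have df: "degree f = d + degree g" using g nz dp0 by (simp add: degree_mult_eq)
    have p0n: "p0 \<in> primes_upto n" using p0 dp0 df less.prems by (auto simp: primes_upto_def)
    have lg: "lead_coeff g = 1" using g less.prems dp0 by (simp add: lead_coeff_mult)
    have IH: "degree g = (\<Sum>(p, j)\<in>?A g. degree p)"
      using less.hyps[of g] df dp0 lg less.prems by simp
    \<comment> \<open>The contribution of \<open>p0\<close> is separated from that of the other
      primes: passing from \<open>g\<close> to \<open>f = p0 * g\<close> leaves \<open>C\<close>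
      unchanged and adds exactly one exponent to \<open>B\<close>.\<close>
    define B where "B h = {j\<in>{1..n}. p0 ^ j dvd (h :: 'a poly)}" for h
    define C where "C h = {(p, j). p \<in> primes_upto n - {p0} \<and> j \<in> {1..n} \<and> p ^ j dvd (h :: 'a poly)}" for h
    have split: "?A h = C h \<union> Pair p0 ` B h" for h
      using p0n by (auto simp: B_def C_def)
    have finC: "finite (C h)" for h
      using fin[of h] unfolding split[of h] by simp
    have sum_eq: "(\<Sum>(p, j)\<in>?A h. degree p) = (\<Sum>(p, j)\<in>C h. degree p) + card (B h) * d" for h
      unfolding split
      by (subst sum.union_disjoint)
         (use finC in \<open>auto simp: B_def C_def sum.reindex inj_on_def dp0\<close>)
    have pow_dvd: "p ^ j dvd p0 * g \<longleftrightarrow> p ^ j dvd g" if "p \<in> primes_upto n - {p0}" for p j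
    proof
      assume "p ^ j dvd p0 * g"
      moreover have "\<not> p dvd p0"
        using that p0(1) irrd irr_dvd_irr by (metis DiffE insertI1)
      moreover have "prime_elem p" using that irrd irr_prime_elem by blast
      ultimately show "p ^ j dvd g" using prime_elem_power_dvd_cases[of p j p0 g 1 j] by simp
    qed auto
    then have "C f = C g" unfolding C_def g by blast
    moreover have "card (B f) = Suc (card (B g))"
    proof -
      \<comment> \<open>\<open>p0 ^ Suc i\<close> divides \<open>p0 * g\<close> exactly when
        \<open>p0 ^ i\<close> divides \<open>g\<close>. That the shifted exponent still lies below
        \<open>n\<close> follows from the degree bound on \<open>f\<close>.\<close>
      have "B f = insert 1 (Suc ` B g)"
      proof (intro set_eqI iffI)
        fix j assume j: "j \<in> B f"
        show "j \<in> insert 1 (Suc ` B g)"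
        proof (cases "j = 1")
          case False
          with j obtain i where i: "j = Suc i" "i \<ge> 1" "i \<le> n" 
            by (cases j) (auto simp: B_def)
          then have "p0 ^ i dvd g" using j nz by (simp add: B_def g)
          then show ?thesis using i by (auto simp: B_def)
        qed simp
      next
        fix j assume "j \<in> insert 1 (Suc ` B g)"
        then consider "j = 1" | i where "j = Suc i" "i \<in> B g" by auto
        then show "j \<in> B f"
        proof cases
          case 1
          then show ?thesis using df dp0 less.prems by (auto simp: B_def g)
        next
          case 2
          then have "p0 ^ i dvd g" by (simp add: B_def)
          then have "degree (p0 ^ i) \<le> degree g" using nz dvd_imp_degree_le by blast
          then have "i * d \<le> degree g" using dp0 nz by (simp add: degree_power_eq)
          moreover have "i \<le> i * d" using dp0 by simp
          ultimately have "Suc i \<le> n" using df dp0(2) less.prems by linarith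
          then show ?thesis using 2 by (auto simp: B_def g)
        qed
      qed
      moreover have "1 \<notin> Suc ` B g" by (auto simp: B_def)
      moreover have "finite (B g)" by (simp add: B_def)
      ultimately show ?thesis by (simp add: card_image)
    qed
    ultimately show ?thesis using IH sum_eq[of f] sum_eq[of g] df by simp
  qed
qed

lemma sum_primes_upto:
  "(\<Sum>p\<in>(primes_upto n :: 'a::{finite,field} poly set). g (degree p)) =
    (\<Sum>d\<in>{1..n}. real (card (irr d :: 'a poly set)) * g d)"
proof -
  have "(\<Sum>p\<in>(primes_upto n :: 'a poly set). g (degree p)) = (\<Sum>d\<in>{1..n}. \<Sum>p\<in>(irr d :: 'a poly set). g (degree p))"
    unfolding primes_upto_def by (rule sum.UNION_disjoint) (auto, auto simp: irr_def)
  also have "\<dots> = (\<Sum>d\<in>{1..n}. \<Sum>p\<in>(irr d :: 'a poly set). g d)"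
    by (intro sum.cong) (auto simp: irr_def)
  finally show ?thesis by simp
qed

lemma mult_le_subset:
  "{(d, j). 1 \<le> d \<and> 1 \<le> j \<and> j * d \<le> (n::nat)} \<subseteq> {1..n} \<times> {1..n}"
proof (rule subrelI)
  fix d j :: nat
  assume "(d, j) \<in> {(d, j). 1 \<le> d \<and> 1 \<le> j \<and> j * d \<le> n}"
  then have "1 \<le> d" "1 \<le> j" "j * d \<le> n" by auto
  moreover have "d \<le> j * d" "j \<le> j * d" using \<open>1 \<le> d\<close> \<open>1 \<le> j\<close> by simp_all
  ultimately have "d \<le> n" "j \<le> n" by linarith+
  with \<open>1 \<le> d\<close> \<open>1 \<le> j\<close> show "(d, j) \<in> {1..n} \<times> {1..n}" by simp
qed

lemma finite_mult_le: "finite {(d, j). 1 \<le> d \<and> 1 \<le> j \<and> j * d \<le> (n::nat)}"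
  by (rule finite_subset[OF mult_le_subset]) simp

text \<open>The previous identity is summed over all monic \<open>f\<close> of degree
  \<open>n\<close>: \<open>p ^ j\<close> divides a fraction \<open>1 / q ^ (j * degree p)\<close> of
  them if \<open>j * degree p \<le> n\<close>, and none otherwise. Primes are then grouped by
  degree.\<close>

lemma sum_prime_power_degrees:
  "real n = (\<Sum>(d, j)\<in>{(d, j). 1 \<le> d \<and> 1 \<le> j \<and> j * d \<le> n}.
     real d * real (card (irr d :: 'a::{finite,field} poly set)) / real CARD('a) ^ (j * d))"
proof -
  let ?q = "real CARD('a)"
  let ?P = "primes_upto n :: 'a poly set"
  let ?M = "monic_polys n :: 'a poly set"
  define N where "N d = real (card (irr d :: 'a poly set))" for d
  have finP: "finite ?P" by (simp add: primes_upto_def)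
  have deg: "real n = (\<Sum>p\<in>?P. \<Sum>j\<in>{1..n}. if p ^ j dvd f then real (degree p) else 0)"
    if "f \<in> ?M" for f
  proof -
    have "real n = (\<Sum>(p, j)\<in>{(p, j). p \<in> ?P \<and> j \<in> {1..n} \<and> p ^ j dvd f}. real (degree p))"
    proof -
      have f: "degree f = n" "lead_coeff f = 1" using that by (auto simp: monic_polys_def)
      show ?thesis
        using arg_cong[OF degree_eq_sum_prime_powers[OF f(2), of n], of real] f(1)
        by (simp add: case_prod_unfold)
    qed
    also have "\<dots> = (\<Sum>(p, j)\<in>?P \<times> {1..n}. if p ^ j dvd f then real (degree p) else 0)"
      using finP by (intro sum.mono_neutral_cong_left) (auto split: if_splits)
    finally show ?thesis by (simp add: sum.cartesian_product)
  qed
  have pw: "(\<Sum>f\<in>?M. if p ^ j dvd f then real (degree p) else 0) =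
      ?q ^ n * (if j * degree p \<le> n then real (degree p) / ?q ^ (j * degree p) else 0)"
    if "p \<in> ?P" for p j
  proof -
    have p0: "p \<noteq> 0" "lead_coeff p = 1" using that by (auto simp: primes_upto_def irr_def)
    have dp: "degree (p ^ j) = j * degree p" "lead_coeff (p ^ j) = 1"
      using p0 degree_power_eq[of p j] lead_coeff_power[of p j] by simp_all
    have "(\<Sum>f\<in>?M. if p ^ j dvd f then real (degree p) else 0) =
        real (degree p) * real (card {f \<in> ?M. p ^ j dvd f})"
      using finite_monic_polys by (subst sum.inter_filter[symmetric]) auto
    also have "\<dots> = ?q ^ n * (if j * degree p \<le> n then real (degree p) / ?q ^ (j * degree p) else 0)"
    proof (cases "j * degree p \<le> n")
      case True
      then have "real (card {f \<in> ?M. p ^ j dvd f}) = ?q ^ (n - j * degree p)"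
        using card_multiples[of "p ^ j" n] dp by simp
      then show ?thesis using True by (simp add: power_diff)
    next
      case False
      have "{f \<in> ?M. p ^ j dvd f} = {}"
      proof (rule ccontr)
        assume "{f \<in> ?M. p ^ j dvd f} \<noteq> {}"
        then obtain f where f: "f \<in> ?M" "p ^ j dvd f" by auto
        then have "f \<noteq> 0" "degree f = n" by (auto simp: monic_polys_def)
        then show False using dvd_imp_degree_le[OF f(2)] dp False by simp
      qed
      then show ?thesis using False by (simp only: if_False card.empty)
    qed
    finally show ?thesis .
  qed
  have "?q ^ n * real n = (\<Sum>f\<in>?M. real n)"
    by (simp add: card_monic_polys)
  also have "\<dots> = (\<Sum>f\<in>?M. \<Sum>p\<in>?P. \<Sum>j\<in>{1..n}. if p ^ j dvd f then real (degree p) else 0)"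
    by (rule sum.cong[OF refl deg])
  also have "\<dots> = (\<Sum>p\<in>?P. \<Sum>j\<in>{1..n}. \<Sum>f\<in>?M. if p ^ j dvd f then real (degree p) else 0)"
    by (subst sum.swap, rule sum.cong[OF refl], rule sum.swap)
  also have "\<dots> = (\<Sum>p\<in>?P. \<Sum>j\<in>{1..n}.
      ?q ^ n * (if j * degree p \<le> n then real (degree p) / ?q ^ (j * degree p) else 0))"
    by (intro sum.cong refl pw)
  also have "\<dots> = ?q ^ n * (\<Sum>p\<in>?P. \<Sum>j\<in>{1..n}.
      if j * degree p \<le> n then real (degree p) / ?q ^ (j * degree p) else 0)"
    by (simp add: sum_distrib_left)
  finally have "real n = (\<Sum>p\<in>?P. \<Sum>j\<in>{1..n}.
      if j * degree p \<le> n then real (degree p) / ?q ^ (j * degree p) else 0)"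
    by (subst (asm) mult_cancel_left) simp
  also have "\<dots> = (\<Sum>d\<in>{1..n}. N d * (\<Sum>j\<in>{1..n}. if j * d \<le> n then real d / ?q ^ (j * d) else 0))"
    unfolding N_def by (rule sum_primes_upto)
  also have "\<dots> = (\<Sum>(d, j)\<in>{1..n} \<times> {1..n}. if j * d \<le> n then real d * N d / ?q ^ (j * d) else 0)"
    unfolding sum.cartesian_product[symmetric] sum_distrib_left by (intro sum.cong) auto
  also have "\<dots> = (\<Sum>(d, j)\<in>{(d, j). 1 \<le> d \<and> 1 \<le> j \<and> j * d \<le> n}. real d * N d / ?q ^ (j * d))"
  proof (rule sum.mono_neutral_cong_right)
    show "{(d, j). 1 \<le> d \<and> 1 \<le> j \<and> j * d \<le> n} \<subseteq> {1..n} \<times> {1..n}"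
      by (rule mult_le_subset)
  qed (auto split: if_splits)
  finally show ?thesis unfolding N_def .
qed

text \<open>Gauss's identity. Subtracting the averaged identity for \<open>n - 1\<close> from the
  one for \<open>n\<close> leaves the pairs with \<open>j * d = n\<close>, all with the same
  denominator \<open>q ^ n\<close>, and their total is \<open>1\<close>.\<close>

lemma sum_degrees_dvd:
  assumes "n \<ge> 1"
  shows "(\<Sum>(d, j)\<in>{(d, j). 1 \<le> d \<and> 1 \<le> j \<and> j * d = n}.
     real d * real (card (irr d :: 'a::{finite,field} poly set))) = real CARD('a) ^ n"
proof -
  let ?g = "\<lambda>(d, j). real d * real (card (irr d :: 'a poly set)) / real CARD('a) ^ (j * d)"
  let ?Y = "\<lambda>n. {(d, j). 1 \<le> d \<and> 1 \<le> j \<and> j * d \<le> (n::nat)}"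
  have Y: "?Y n = ?Y (n - 1) \<union> {(d, j). 1 \<le> d \<and> 1 \<le> j \<and> j * d = n}"
    using assms by auto
  have fin: "finite (?Y n)" for n by (rule finite_mult_le)
  have fin': "finite {(d, j). 1 \<le> d \<and> 1 \<le> j \<and> j * d = n}"
    by (rule finite_subset[OF _ fin[of n]]) auto
  have "sum ?g (?Y n) = sum ?g (?Y (n - 1)) + sum ?g {(d, j). 1 \<le> d \<and> 1 \<le> j \<and> j * d = n}"
    unfolding Y
  proof (rule sum.union_disjoint)
    show "?Y (n - 1) \<inter> {(d, j). 1 \<le> d \<and> 1 \<le> j \<and> j * d = n} = {}"
    proof -
      have "m \<le> n - 1 \<Longrightarrow> m \<noteq> n" for m using assms by linarith
      then show ?thesis by blast
    qed
  qed (rule fin fin')+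
  then have "sum ?g {(d, j). 1 \<le> d \<and> 1 \<le> j \<and> j * d = n} = 1"
    using sum_prime_power_degrees[of n, where 'a='a] sum_prime_power_degrees[of "n - 1", where 'a='a] assms
    by (simp add: of_nat_diff)
  also have "sum ?g {(d, j). 1 \<le> d \<and> 1 \<le> j \<and> j * d = n} =
      (\<Sum>(d, j)\<in>{(d, j). 1 \<le> d \<and> 1 \<le> j \<and> j * d = n}.
        real d * real (card (irr d :: 'a poly set))) / real CARD('a) ^ n"
    by (subst sum_divide_distrib) (auto intro!: sum.cong)
  finally show ?thesis by simp
qed

text \<open>The pair \<open>(n, 1)\<close> is one of the nonnegative terms in Gauss's
  identity.\<close>

lemma card_irr_upper:
  assumes "n \<ge> 1"
  shows "real n * real (card (irr n :: 'a::{finite,field} poly set)) \<le> real CARD('a) ^ n"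
proof -
  have "finite {(d, j). 1 \<le> d \<and> 1 \<le> j \<and> j * d = n}"
    by (rule finite_subset[OF _ finite_mult_le[of n]]) auto
  then have "(\<lambda>(d, j::nat). real d * real (card (irr d :: 'a poly set))) (n, 1)
     \<le> real CARD('a) ^ n"
    unfolding sum_degrees_dvd[OF assms, where 'a='a, symmetric]
    using assms by (intro member_le_sum) auto
  then show ?thesis by simp
qed

text \<open>The other terms of Gauss's identity come from proper divisors
  \<open>d \<le> n div 2\<close>; there are at most \<open>n\<close> of them, each at most
  \<open>q ^ (n div 2)\<close> by the upper bound.\<close>

lemma card_irr_lower:
  assumes "n \<ge> 1"
  shows "real n * real (card (irr n :: 'a::{finite,field} poly set)) \<ge> 
    real CARD('a) ^ n - real n * real CARD('a) ^ (n div 2)"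
proof -
  let ?g = "\<lambda>(d, j::nat). real d * real (card (irr d :: 'a poly set))"
  let ?Y = "{(d, j). 1 \<le> d \<and> 1 \<le> j \<and> j * d = n}"
  let ?q = "real CARD('a)"
  have fin: "finite ?Y"
    by (rule finite_subset[OF _ finite_mult_le[of n]]) auto
  have q1: "?q \<ge> 1" by (simp add: Suc_leI)
  have inj: "inj_on fst ?Y" by (auto simp: inj_on_def)
  have le: "fst x \<le> n div 2" if x: "x \<in> ?Y - {(n, 1)}" for x
  proof -
    obtain d j where dj: "x = (d, j)" "1 \<le> d" "1 \<le> j" "j * d = n" using x by auto
    with x have "j \<noteq> 1" by auto
    with dj have "2 * d \<le> n" using mult_le_mono1[of 2 j d] by simp
    then show ?thesis using dj by simp
  qed
  have "card (?Y - {(n, 1)}) \<le> card {1..n div 2}"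
    proof (rule card_inj_on_le[of fst])
    show "fst ` (?Y - {(n, 1)}) \<subseteq> {1..n div 2}"
    proof
      fix d assume "d \<in> fst ` (?Y - {(n, 1)})"
      then obtain x where x: "d = fst x" "x \<in> ?Y - {(n, 1)}" by auto
      then have "1 \<le> d" by auto
      then show "d \<in> {1..n div 2}" using le[OF x(2)] x(1) by simp
    qed
  qed (use inj in \<open>auto intro: inj_on_subset\<close>)
  then have "card (?Y - {(n, 1)}) \<le> n" by simp
  have "sum ?g (?Y - {(n, 1)}) \<le> (\<Sum>x\<in>?Y - {(n, 1)}. ?q ^ (n div 2))"
  proof (rule sum_mono)
    fix x assume x: "x \<in> ?Y - {(n, 1)}"
    then obtain d j where dj: "x = (d, j)" "1 \<le> d" by auto
    have "?g x \<le> ?q ^ d" using card_irr_upper[OF dj(2), where 'a='a] dj by simp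
    also have "\<dots> \<le> ?q ^ (n div 2)" using le[OF x] dj q1 by (intro power_increasing) auto
    finally show "?g x \<le> ?q ^ (n div 2)" .
  qed
  also have "\<dots> \<le> real n * ?q ^ (n div 2)"
    using \<open>card (?Y - {(n, 1)}) \<le> n\<close> by (simp add: mult_right_mono)
  finally have "sum ?g (?Y - {(n, 1)}) \<le> real n * ?q ^ (n div 2)" .
  moreover have "sum ?g ?Y = ?g (n, 1) + sum ?g (?Y - {(n, 1)})"
    using fin assms by (intro sum.remove) auto
  ultimately show ?thesis using sum_degrees_dvd[OF assms, where 'a='a] by simp
qed

text \<open>The mean number of chosen irreducibles of degree \<open>d\<close> when each is chosen
  with probability \<open>1 / q ^ d\<close>. The type argument is needed because the real value does
  not determine the field.\<close>

definition expected_irr :: "'a::{finite,field} itself \<Rightarrow> nat \<Rightarrow> real" where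
  "expected_irr _ d = real (card (irr d :: 'a poly set)) / real CARD('a) ^ d"

lemma expected_irr_le: "d \<ge> 1 \<Longrightarrow> expected_irr TYPE('a::{finite,field}) d \<le> 1 / real d"
  using card_irr_upper[of d, where 'a='a]
  by (simp add: expected_irr_def field_simps)

text \<open>The relative error in \<open>card_irr_lower\<close> is exponentially small. Since every
  field has at least two elements, \<open>d ^ 2 \<le> 2 powr (d / 2)\<close> suffices for every
  \<open>q\<close>.\<close>

lemma expected_irr_ge:
  "\<forall>\<^sub>F d in sequentially. expected_irr TYPE('a::{finite,field}) d \<ge> 1 / real d - 1 / real d ^ 2"
proof -
  have "\<forall>\<^sub>F d in sequentially. real d ^ 2 \<le> 2 powr (real d / 2)"
    by real_asymp
  moreover have "\<forall>\<^sub>F d in sequentially. d \<ge> (1::nat)" by (rule eventually_ge_at_top)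
  ultimately show ?thesis
  proof eventually_elim
    case (elim d)
    let ?q = "real CARD('a)"
    have "card {0, 1 :: 'a} \<le> CARD('a)" by (rule card_mono) auto
    then have q2: "?q \<ge> 2" by simp
    have "real d ^ 2 * ?q ^ (d div 2) \<le> ?q powr (real d / 2) * ?q powr (real d / 2)"
    proof (rule mult_mono)
      have "2 powr (real d / 2) \<le> ?q powr (real d / 2)" using q2 by (intro powr_mono2) auto
      then show "real d ^ 2 \<le> ?q powr (real d / 2)" using elim by simp
      have "?q ^ (d div 2) = ?q powr real (d div 2)" using q2 by (simp add: powr_realpow)
      also have "\<dots> \<le> ?q powr (real d / 2)"
        using q2 by (intro powr_mono) linarith+
      finally show "?q ^ (d div 2) \<le> ?q powr (real d / 2)" .
    qed auto
    also have "\<dots> = ?q ^ d" using q2 by (simp add: powr_add[symmetric] powr_realpow)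
    finally have "real d * (real d * ?q ^ (d div 2)) \<le> ?q ^ d"
      by (simp add: power2_eq_square mult.assoc)
    moreover have "real d * (real d * real (card (irr d :: 'a poly set))) \<ge>
        real d * (?q ^ d - real d * ?q ^ (d div 2))"
      using card_irr_lower[of d, where 'a='a] elim by (intro mult_left_mono) auto
    ultimately have "real d ^ 2 * real (card (irr d :: 'a poly set)) \<ge> (real d - 1) * ?q ^ d"
      by (simp add: algebra_simps power2_eq_square)
    then have "real (card (irr d :: 'a poly set)) / ?q ^ d \<ge> (real d - 1) / real d ^ 2"
      using q2 elim by (simp add: field_simps)
    then show ?case using elim by (simp add: expected_irr_def diff_divide_distrib power2_eq_square)
  qed
qed

section \<open>Comparison of random sets\<close>

lemma sum_subsets_by_card:
  assumes "finite T"
  shows "(\<Sum>U\<in>{U\<in>Pow T. card U \<le> L}. g (card U)) = (\<Sum>l\<le>L. real (card T choose l) * g l)"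
proof -
  have "(\<Sum>U\<in>{U\<in>Pow T. card U \<le> L}. g (card U)) =
      (\<Sum>l\<le>L. \<Sum>U\<in>{U\<in>{U\<in>Pow T. card U \<le> L}. card U = l}. g (card U))"
    using assms by (intro sum.group[symmetric]) auto
  also have "\<dots> = (\<Sum>l\<le>L. \<Sum>U\<in>{U. U \<subseteq> T \<and> card U = l}. g l)"
    by (intro sum.cong) auto
  finally show ?thesis using n_subsets[OF assms] by simp
qed

text \<open>Extending an \<open>l\<close>-set to an \<open>L\<close>-set gives
  \<open>card T choose l \<le> (card T choose L) * (L choose l)\<close>, and the binomial theorem
  sums \<open>(L choose l) * 2 ^ l\<close> to \<open>3 ^ L\<close>. The bound has the form of a
  binomial moment, which can be averaged.\<close>

lemma sum_subsets_pow2_le: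
  assumes "finite T" "card T \<ge> L"
  shows "(\<Sum>U\<in>{U\<in>Pow T. card U \<le> L}. 2 ^ card U) \<le> 3 ^ L * real (card T choose L)"
proof -
  have "(\<Sum>U\<in>{U\<in>Pow T. card U \<le> L}. 2 ^ card U) = (\<Sum>l\<le>L. real (card T choose l) * 2 ^ l)"
    using assms by (intro sum_subsets_by_card)
  also have "\<dots> \<le> (\<Sum>l\<le>L. real (card T choose L) * (real (L choose l) * 2 ^ l))"
  proof (rule sum_mono)
    fix l assume l: "l \<in> {..L}"
    have "card T choose l \<le> (card T choose l) * ((card T - l) choose (L - l))"
    proof -
      have "(card T - l) choose (L - l) > 0" using assms by simp
      then have "1 \<le> (card T - l) choose (L - l)" by linarith
      then show ?thesis using mult_le_mono2[of 1 _ "card T choose l"] by simp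
    qed
    also have "\<dots> = (card T choose L) * (L choose l)"
      using l assms by (intro choose_mult[symmetric]) auto
    finally have "real (card T choose l) \<le> real (card T choose L) * real (L choose l)"
      by (simp flip: of_nat_mult)
    then show "real (card T choose l) * 2 ^ l \<le> real (card T choose L) * (real (L choose l) * 2 ^ l)"
      by (simp add: mult.assoc[symmetric])
  qed
  also have "\<dots> = real (card T choose L) * (2 + 1) ^ L"
    unfolding binomial_ring by (simp add: sum_distrib_left)
  finally show ?thesis by (simp add: mult.commute)
qed

text \<open>Moebius inversion over subsets writes \<open>h T\<close> as the full sum of coefficients
  with \<open>\<bar>a U\<bar> \<le> 2 ^ card U\<close>. Truncation is exact for
  \<open>card T \<le> L\<close>; beyond that \<open>card T choose L \<ge> 1\<close> pays for both
  terms separately. The coefficients do not depend on \<open>T\<close>, so the expansion can be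
  averaged.\<close>

lemma moebius_truncation:
  fixes h :: "'b set \<Rightarrow> real"
  assumes h: "\<And>T. h T \<in> {0..1}"
  shows "\<exists>a :: 'b set \<Rightarrow> real. \<forall>T. finite T \<longrightarrow>
    \<bar>h T - (\<Sum>U\<in>{U\<in>Pow T. card U \<le> L}. a U)\<bar> \<le> (3 ^ L + 1) * real (card T choose L)"
proof -
  \<comment> \<open>The signs are split between \<open>g\<close> and \<open>a\<close> to match
    \<open>inclusion_exclusion_symmetric\<close>.\<close>
  define g where "g U = (\<Sum>V\<in>Pow U. (-1) ^ card V * h V)" for U
  define a where "a U = (-1) ^ card U * g U" for U
  have h_eq: "h T = sum a (Pow T)" if "finite T" for T
    unfolding a_def by (rule inclusion_exclusion_symmetric[OF _ that]) (simp add: g_def)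
  have a_le: "\<bar>a U\<bar> \<le> 2 ^ card U" if "finite U" for U
  proof -
    have "\<bar>g U\<bar> \<le> (\<Sum>V\<in>Pow U. \<bar>(-1) ^ card V * h V\<bar>)" unfolding g_def by (rule sum_abs)
    also have "\<dots> \<le> (\<Sum>V\<in>Pow U. 1)"
      using h by (intro sum_mono) (simp add: abs_mult power_abs)
    finally show ?thesis using that by (simp add: a_def abs_mult power_abs card_Pow)
  qed
  have "\<bar>h T - (\<Sum>U\<in>{U\<in>Pow T. card U \<le> L}. a U)\<bar> \<le> (3 ^ L + 1) * real (card T choose L)"
    (is "\<bar>h T - ?s\<bar> \<le> _") if T: "finite T" for T
  proof (cases "card T \<le> L")
    case True
    then have "{U\<in>Pow T. card U \<le> L} = Pow T"
      using T by (auto intro: card_mono order_trans)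
    then show ?thesis using h_eq[OF T] by simp
  next
    case False
    have "\<bar>?s\<bar> \<le> (\<Sum>U\<in>{U\<in>Pow T. card U \<le> L}. \<bar>a U\<bar>)" by (rule sum_abs)
    also have "\<dots> \<le> (\<Sum>U\<in>{U\<in>Pow T. card U \<le> L}. 2 ^ card U)"
      using T by (intro sum_mono a_le) (auto intro: finite_subset)
    also have "\<dots> \<le> 3 ^ L * real (card T choose L)"
      using False T by (intro sum_subsets_pow2_le) auto
    finally have "\<bar>?s\<bar> \<le> 3 ^ L * real (card T choose L)" .
    moreover have "real (card T choose L) \<ge> 1"
      using False by (simp add: Suc_le_eq)
    moreover have "\<bar>h T\<bar> \<le> 1" using h[of T] by auto
    ultimately show ?thesis by (simp add: algebra_simps)
  qed
  then show ?thesis by blast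
qed

text \<open>Expresses the mean of an expansion through the masses of the families
  \<open>{T. U \<subseteq> T}\<close>, the joint moments that are known exactly for
  polynomials.\<close>

lemma sum_superset_swap:
  fixes w :: "'b set \<Rightarrow> real"
  assumes "finite J"
  shows "(\<Sum>T\<in>Pow J. w T * (\<Sum>U\<in>{U\<in>Pow T. Q U}. a U)) =
    (\<Sum>U\<in>{U\<in>Pow J. Q U}. a U * (\<Sum>T\<in>{T\<in>Pow J. U \<subseteq> T}. w T))"
proof -
  have "(\<Sum>T\<in>Pow J. w T * (\<Sum>U\<in>{U\<in>Pow T. Q U}. a U)) =
      (\<Sum>T\<in>Pow J. \<Sum>U\<in>{U\<in>{U\<in>Pow J. Q U}. U \<subseteq> T}. a U * w T)"
    unfolding sum_distrib_left by (intro sum.cong) auto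
  also have "\<dots> = (\<Sum>U\<in>{U\<in>Pow J. Q U}. \<Sum>T\<in>{T\<in>Pow J. U \<subseteq> T}. a U * w T)"
    using assms by (intro sum.swap_restrict) auto
  finally show ?thesis by (simp add: sum_distrib_left)
qed

text \<open>The truncated Moebius expansion of \<open>h\<close> has the same sum against both weights, so only the
  truncation error remains.\<close>
lemma moment_comparison:
  fixes w w' :: "'b set \<Rightarrow> real"
  assumes J: "finite J"
    and w: "\<And>T. T \<subseteq> J \<Longrightarrow> w T \<ge> 0" and w': "\<And>T. T \<subseteq> J \<Longrightarrow> w' T \<ge> 0"
    and eq: "\<And>U. U \<subseteq> J \<Longrightarrow> card U \<le> L \<Longrightarrow>
      (\<Sum>T\<in>{T\<in>Pow J. U \<subseteq> T}. w T) = (\<Sum>T\<in>{T\<in>Pow J. U \<subseteq> T}. w' T)"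
    and h: "\<And>T. h T \<in> {0..1}"
  shows "\<bar>(\<Sum>T\<in>Pow J. w T * h T) - (\<Sum>T\<in>Pow J. w' T * h T)\<bar> \<le>
    2 * (3 ^ L + 1) * (\<Sum>U\<in>{U\<in>Pow J. card U = L}. \<Sum>T\<in>{T\<in>Pow J. U \<subseteq> T}. w' T)"
proof -
  obtain a where a: "\<And>T. finite T \<Longrightarrow>
      \<bar>h T - (\<Sum>U\<in>{U\<in>Pow T. card U \<le> L}. a U)\<bar> \<le> (3 ^ L + 1) * real (card T choose L)"
    using moebius_truncation[of h L, OF h] by blast
  define s where "s T = (\<Sum>U\<in>{U\<in>Pow T. card U \<le> L}. a U)" for T
  have main: "(\<Sum>T\<in>Pow J. w T * s T) = (\<Sum>T\<in>Pow J. w' T * s T)"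
    unfolding s_def sum_superset_swap[OF J] by (rule sum.cong[OF refl], subst eq) auto
  \<comment> \<open>The mean of \<open>card T choose L\<close> is the sum of the joint moments over
    all \<open>L\<close>-sets.\<close>
  have moment: "(\<Sum>T\<in>Pow J. v T * real (card T choose L)) =
      (\<Sum>U\<in>{U\<in>Pow J. card U = L}. \<Sum>T\<in>{T\<in>Pow J. U \<subseteq> T}. v T)" for v :: "'b set \<Rightarrow> real"
  proof -
    have "(\<Sum>T\<in>Pow J. v T * real (card T choose L)) =
        (\<Sum>T\<in>Pow J. v T * (\<Sum>U\<in>{U\<in>Pow T. card U = L}. 1))"
      using J by (intro sum.cong) (auto simp: n_subsets finite_subset)
    then show ?thesis unfolding sum_superset_swap[OF J] by simp
  qed
  have err: "\<bar>(\<Sum>T\<in>Pow J. v T * h T) - (\<Sum>T\<in>Pow J. v T * s T)\<bar> \<le>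
      (3 ^ L + 1) * (\<Sum>U\<in>{U\<in>Pow J. card U = L}. \<Sum>T\<in>{T\<in>Pow J. U \<subseteq> T}. v T)"
    if v: "\<And>T. T \<subseteq> J \<Longrightarrow> v T \<ge> 0" for v
  proof -
    have "\<bar>(\<Sum>T\<in>Pow J. v T * h T) - (\<Sum>T\<in>Pow J. v T * s T)\<bar> = \<bar>\<Sum>T\<in>Pow J. v T * (h T - s T)\<bar>"
      by (simp add: algebra_simps sum_subtractf)
    also have "\<dots> \<le> (\<Sum>T\<in>Pow J. \<bar>v T * (h T - s T)\<bar>)" by (rule sum_abs)
    also have "\<dots> \<le> (\<Sum>T\<in>Pow J. (3 ^ L + 1) * (v T * real (card T choose L)))"
    proof (rule sum_mono)
      fix T assume T: "T \<in> Pow J"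
      then have "\<bar>v T * (h T - s T)\<bar> \<le> v T * ((3 ^ L + 1) * real (card T choose L))"
        using v[of T] a[of T] finite_subset[OF _ J, of T] unfolding s_def
        by (simp add: abs_mult mult_left_mono)
      then show "\<bar>v T * (h T - s T)\<bar> \<le> (3 ^ L + 1) * (v T * real (card T choose L))"
        by (simp add: mult_ac)
    qed
    finally show ?thesis by (simp add: moment flip: sum_distrib_left)
  qed
  \<comment> \<open>The truncation error under \<open>w\<close> consists of moments of order exactly
    \<open>L\<close>, which still agree, so both errors are measured by \<open>w'\<close>.\<close>
  have "(\<Sum>U\<in>{U\<in>Pow J. card U = L}. \<Sum>T\<in>{T\<in>Pow J. U \<subseteq> T}. w T) =
      (\<Sum>U\<in>{U\<in>Pow J. card U = L}. \<Sum>T\<in>{T\<in>Pow J. U \<subseteq> T}. w' T)"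
    by (rule sum.cong[OF refl], rule eq) auto
  then show ?thesis using err[of w, OF w] err[of w', OF w'] main by (simp add: algebra_simps)
qed

text \<open>The probability that independent events with probabilities \<open>p x\<close>, for
  \<open>x\<close> in \<open>J\<close>, occur exactly on \<open>R\<close>. Working with this product
  for finite \<open>J\<close> reduces all comparisons to finite sums.\<close>

definition bernoulli_weight :: "('b \<Rightarrow> real) \<Rightarrow> 'b set \<Rightarrow> 'b set \<Rightarrow> real" where
  "bernoulli_weight p J R = (\<Prod>x\<in>R. p x) * (\<Prod>x\<in>J - R. 1 - p x)"

lemma bernoulli_weight_nonneg:
  assumes "\<And>x. x \<in> J \<Longrightarrow> p x \<in> {0..1}" "R \<subseteq> J"
  shows "bernoulli_weight p J R \<ge> 0"
  unfolding bernoulli_weight_def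
  by (intro mult_nonneg_nonneg prod_nonneg) (use assms in \<open>auto simp: subset_iff\<close>)

text \<open>This is the expansion of the product over \<open>J\<close> of
  \<open>p x + (1 - p x)\<close>.\<close>

lemma sum_bernoulli_weight: "finite J \<Longrightarrow> (\<Sum>R\<in>Pow J. bernoulli_weight p J R) = 1"
  unfolding bernoulli_weight_def by (subst prod_add[symmetric]) auto

lemma sum_Pow_disjoint:
  assumes "A \<inter> B = {}"
  shows "(\<Sum>R\<in>Pow (A \<union> B). g R) = (\<Sum>R\<in>Pow A. \<Sum>S\<in>Pow B. g (R \<union> S))"
proof -
  have "(\<Sum>R\<in>Pow A. \<Sum>S\<in>Pow B. g (R \<union> S)) = (\<Sum>(R, S)\<in>Pow A \<times> Pow B. g (R \<union> S))"
    by (rule sum.cartesian_product)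
  also have "\<dots> = (\<Sum>R\<in>Pow (A \<union> B). g R)"
    by (rule sum.reindex_bij_witness[of _ "\<lambda>R. (R \<inter> A, R \<inter> B)" "\<lambda>(R, S). R \<union> S"])
       (use assms in auto)
  finally show ?thesis ..
qed

lemma bernoulli_weight_Un:
  assumes "A \<inter> B = {}" "finite A" "finite B" "R \<subseteq> A" "S \<subseteq> B"
  shows "bernoulli_weight p (A \<union> B) (R \<union> S) = bernoulli_weight p A R * bernoulli_weight p B S"
proof -
  have "A \<union> B - (R \<union> S) = (A - R) \<union> (B - S)" using assms by auto
  moreover have "finite R" "finite S" using assms finite_subset by blast+
  moreover have "R \<inter> S = {}" "(A - R) \<inter> (B - S) = {}" using assms by auto
  ultimately show ?thesis
    using assms by (simp add: bernoulli_weight_def prod.union_disjoint)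
qed

lemma sum_bernoulli_weight_Un:
  assumes "A \<inter> B = {}" "finite A" "finite B"
  shows "(\<Sum>R\<in>Pow (A \<union> B). bernoulli_weight p (A \<union> B) R * g R) =
    (\<Sum>R\<in>Pow A. \<Sum>S\<in>Pow B. bernoulli_weight p A R * bernoulli_weight p B S * g (R \<union> S))"
  unfolding sum_Pow_disjoint[OF assms(1)]
  by (intro sum.cong refl) (use assms in \<open>simp add: bernoulli_weight_Un\<close>)

text \<open>Split \<open>J\<close> into \<open>U\<close> and its complement: the trace on
  \<open>U\<close> is forced to be all of \<open>U\<close>, and the weights on the complement sum to
  \<open>1\<close>.\<close>

lemma sum_bernoulli_weight_superset:
  assumes "finite J" "U \<subseteq> J"
  shows "(\<Sum>R\<in>{R\<in>Pow J. U \<subseteq> R}. bernoulli_weight p J R) = (\<Prod>x\<in>U. p x)"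
proof -
  have J: "J = U \<union> (J - U)" using assms by auto
  have fin: "finite U" "finite (J - U)" using assms finite_subset by auto
  have "(\<Sum>R\<in>{R\<in>Pow J. U \<subseteq> R}. bernoulli_weight p J R) =
      (\<Sum>R\<in>Pow J. bernoulli_weight p J R * (if U \<subseteq> R then 1 else 0))"
    using assms by (subst sum.inter_filter) (auto intro!: sum.cong)
  also have "\<dots> = (\<Sum>R\<in>Pow U. \<Sum>S\<in>Pow (J - U). bernoulli_weight p U R * bernoulli_weight p (J - U) S *
      (if U \<subseteq> R \<union> S then 1 else 0))"
    by (subst (1 2) J, rule sum_bernoulli_weight_Un) (use fin in auto)
  also have "\<dots> = (\<Sum>R\<in>Pow U. if R = U then bernoulli_weight p U R else 0)"
  proof (rule sum.cong[OF refl])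
    fix R assume R: "R \<in> Pow U"
    then have "U \<subseteq> R \<union> S \<longleftrightarrow> R = U" if "S \<in> Pow (J - U)" for S using that by auto
    then have "(\<Sum>S\<in>Pow (J - U). bernoulli_weight p U R * bernoulli_weight p (J - U) S *
        (if U \<subseteq> R \<union> S then 1 else 0)) =
        (\<Sum>S\<in>Pow (J - U). (if R = U then bernoulli_weight p U R else 0) * bernoulli_weight p (J - U) S)"
      by (intro sum.cong refl) simp
    then show "(\<Sum>S\<in>Pow (J - U). bernoulli_weight p U R * bernoulli_weight p (J - U) S *
        (if U \<subseteq> R \<union> S then 1 else 0)) = (if R = U then bernoulli_weight p U R else 0)"
      unfolding sum_distrib_left[symmetric] sum_bernoulli_weight[OF fin(2)] by simp
  qed
  also have "\<dots> = bernoulli_weight p U U" using fin by simp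
  finally show ?thesis by (simp add: bernoulli_weight_def)
qed

text \<open>A block \<open>B i\<close> is hit with probability \<open>1 - (\<Prod>x\<in>B i. 1 - p x)\<close>, independently of the other
  blocks; the blocks are replaced one at a time by independent events of probability \<open>r i\<close>.\<close>
lemma bernoulli_weight_blocks:
  fixes B :: "'i \<Rightarrow> 'b set" and r :: "'i \<Rightarrow> real"
  assumes "finite I" "\<And>i. i \<in> I \<Longrightarrow> finite (B i)" "disjoint_family_on B I"
    and "\<And>i. i \<in> I \<Longrightarrow> r i \<in> {0..1}"
    and p: "\<And>x. p x \<in> {0..1}"
    and "\<And>T. h T \<in> {0..1}"
  shows "\<bar>(\<Sum>R\<in>Pow (\<Union>i\<in>I. B i). bernoulli_weight p (\<Union>i\<in>I. B i) R * h {i\<in>I. R \<inter> B i \<noteq> {}}) -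
      (\<Sum>T\<in>Pow I. bernoulli_weight r I T * h T)\<bar> \<le> (\<Sum>i\<in>I. \<bar>1 - (\<Prod>x\<in>B i. 1 - p x) - r i\<bar>)"
  using assms(1-4,6)
proof (induction I arbitrary: h rule: finite_induct)
  case empty
  then show ?case by (simp add: bernoulli_weight_def)
next
  case (insert d I)
  let ?A = "B d" and ?B = "\<Union>i\<in>I. B i"
  define \<pi> where "\<pi> = 1 - (\<Prod>x\<in>?A. 1 - p x)"
  \<comment> \<open>\<open>g\<close> averages \<open>h\<close> over whether block \<open>d\<close>
    is hit, with the true probability \<open>\<pi>\<close>; \<open>g'\<close> does so with
    \<open>r d\<close>. As \<open>g\<close> again takes values in \<open>{0..1}\<close>, the
    induction hypothesis applies with \<open>g\<close> in place of \<open>h\<close>.\<close>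
  define g where "g T = (1 - \<pi>) * h T + \<pi> * h (insert d T)" for T
  define g' where "g' T = (1 - r d) * h T + r d * h (insert d T)" for T
  have disj: "?A \<inter> ?B = {}"
    using insert.prems(2) insert.hyps by (fastforce simp: disjoint_family_on_def)
  have fin: "finite ?A" "finite ?B" using insert.prems insert.hyps by auto
  have pi01: "\<pi> \<in> {0..1}"
    using prod_le_1[of ?A "\<lambda>x. 1 - p x"] prod_nonneg[of ?A "\<lambda>x. 1 - p x"] p by (auto simp: \<pi>_def)
  have h01: "h T \<ge> 0" "h T \<le> 1" for T using insert.prems(4)[of T] by auto
  have g01: "g T \<in> {0..1}" for T
    unfolding g_def using pi01 h01[of T] h01[of "insert d T"]
    by (auto intro!: convex_bound_le add_nonneg_nonneg)
  \<comment> \<open>Only the empty trace misses the block, and it has weight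
    \<open>1 - \<pi>\<close>.\<close>
  have blk: "(\<Sum>R\<in>Pow ?A. bernoulli_weight p ?A R * (if R = {} then x else y)) = (1 - \<pi>) * x + \<pi> * y" for x y
  proof -
    have "(\<Sum>R\<in>Pow ?A. bernoulli_weight p ?A R * (if R = {} then x else y)) =
        (\<Sum>R\<in>Pow ?A. bernoulli_weight p ?A R * y + (if R = {} then bernoulli_weight p ?A R * (x - y) else 0))"
      by (intro sum.cong) (auto simp: algebra_simps)
    also have "\<dots> = y + bernoulli_weight p ?A {} * (x - y)"
      using fin by (simp add: sum.distrib sum_bernoulli_weight flip: sum_distrib_right)
    finally show ?thesis by (simp add: bernoulli_weight_def \<pi>_def algebra_simps)
  qed
  have "(\<Sum>R\<in>Pow (\<Union>i\<in>insert d I. B i). bernoulli_weight p (\<Union>i\<in>insert d I. B i) R *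
        h {i\<in>insert d I. R \<inter> B i \<noteq> {}}) =
      (\<Sum>R\<in>Pow ?A. \<Sum>S\<in>Pow ?B. bernoulli_weight p ?A R * bernoulli_weight p ?B S *
        h {i\<in>insert d I. (R \<union> S) \<inter> B i \<noteq> {}})"
    using sum_bernoulli_weight_Un[OF disj fin] by simp
  also have "\<dots> = (\<Sum>S\<in>Pow ?B. \<Sum>R\<in>Pow ?A. bernoulli_weight p ?A R * bernoulli_weight p ?B S *
        h {i\<in>insert d I. (R \<union> S) \<inter> B i \<noteq> {}})"
    by (rule sum.swap)
  also have "\<dots> = (\<Sum>S\<in>Pow ?B. bernoulli_weight p ?B S * g {i\<in>I. S \<inter> B i \<noteq> {}})"
  proof (rule sum.cong[OF refl])
    fix S assume S: "S \<in> Pow ?B"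
    let ?T = "{i\<in>I. S \<inter> B i \<noteq> {}}"
    have *: "{i\<in>insert d I. (R \<union> S) \<inter> B i \<noteq> {}} = (if R = {} then ?T else insert d ?T)"
      if "R \<in> Pow ?A" for R
    proof -
      have "S \<inter> B d = {}" using S disj by auto
      moreover have "R \<inter> B i = {}" if "i \<in> I" for i
        using that \<open>R \<in> Pow ?A\<close> disj by blast
      ultimately show ?thesis using that insert.hyps by auto
    qed
    have "(\<Sum>R\<in>Pow ?A. bernoulli_weight p ?A R * bernoulli_weight p ?B S *
        h {i\<in>insert d I. (R \<union> S) \<inter> B i \<noteq> {}}) =
        (\<Sum>R\<in>Pow ?A. bernoulli_weight p ?B S * (bernoulli_weight p ?A R * (if R = {} then h ?T else h (insert d ?T))))"
      by (intro sum.cong refl) (simp only: * if_distrib[of h] mult_ac)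
    then show "(\<Sum>R\<in>Pow ?A. bernoulli_weight p ?A R * bernoulli_weight p ?B S *
        h {i\<in>insert d I. (R \<union> S) \<inter> B i \<noteq> {}}) = bernoulli_weight p ?B S * g ?T"
      unfolding g_def blk[symmetric] by (simp add: sum_distrib_left)
  qed
  finally have 1: "(\<Sum>R\<in>Pow (\<Union>i\<in>insert d I. B i). bernoulli_weight p (\<Union>i\<in>insert d I. B i) R *
        h {i\<in>insert d I. R \<inter> B i \<noteq> {}}) =
      (\<Sum>S\<in>Pow ?B. bernoulli_weight p ?B S * g {i\<in>I. S \<inter> B i \<noteq> {}})" .
  have "(\<Sum>T\<in>Pow (insert d I). bernoulli_weight r (insert d I) T * h T) =
      (\<Sum>R\<in>Pow {d}. \<Sum>S\<in>Pow I. bernoulli_weight r {d} R * bernoulli_weight r I S * h (R \<union> S))"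
    using sum_bernoulli_weight_Un[of "{d}" I r h] insert.hyps by simp
  also have "\<dots> = (\<Sum>T\<in>Pow I. bernoulli_weight r I T * g' T)"
  proof -
    have "Pow {d} = {{}, {d}}" by auto
    then have "(\<Sum>R\<in>Pow {d}. \<Sum>S\<in>Pow I. bernoulli_weight r {d} R * bernoulli_weight r I S * h (R \<union> S)) =
        (\<Sum>S\<in>Pow I. (1 - r d) * bernoulli_weight r I S * h S) +
        (\<Sum>S\<in>Pow I. r d * bernoulli_weight r I S * h (insert d S))"
      by (simp add: bernoulli_weight_def[of r "{d}"])
    also have "\<dots> = (\<Sum>T\<in>Pow I. bernoulli_weight r I T * g' T)"
      unfolding sum.distrib[symmetric] g'_def by (intro sum.cong) (auto simp: algebra_simps)
    finally show ?thesis .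
  qed
  finally have 2: "(\<Sum>T\<in>Pow (insert d I). bernoulli_weight r (insert d I) T * h T) =
      (\<Sum>T\<in>Pow I. bernoulli_weight r I T * g' T)" .
  have "disjoint_family_on B I"
    using insert.prems(2) by (auto simp: disjoint_family_on_def)
  then have 3: "\<bar>(\<Sum>S\<in>Pow ?B. bernoulli_weight p ?B S * g {i\<in>I. S \<inter> B i \<noteq> {}}) -
      (\<Sum>T\<in>Pow I. bernoulli_weight r I T * g T)\<bar> \<le> (\<Sum>i\<in>I. \<bar>1 - (\<Prod>x\<in>B i. 1 - p x) - r i\<bar>)"
    using insert.prems g01 by (intro insert.IH) auto
  \<comment> \<open>Exchanging \<open>\<pi>\<close> for \<open>r d\<close> costs at most
    \<open>\<bar>\<pi> - r d\<bar>\<close>, since \<open>h\<close> varies by at most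
    \<open>1\<close> and the weights sum to \<open>1\<close>.\<close>
  have "\<bar>(\<Sum>T\<in>Pow I. bernoulli_weight r I T * g T) - (\<Sum>T\<in>Pow I. bernoulli_weight r I T * g' T)\<bar> =
      \<bar>\<Sum>T\<in>Pow I. bernoulli_weight r I T * (g T - g' T)\<bar>"
    by (simp add: algebra_simps sum_subtractf)
  also have "\<dots> \<le> (\<Sum>T\<in>Pow I. \<bar>bernoulli_weight r I T * (g T - g' T)\<bar>)" by (rule sum_abs)
  also have "\<dots> \<le> (\<Sum>T\<in>Pow I. bernoulli_weight r I T * \<bar>\<pi> - r d\<bar>)"
  proof (rule sum_mono)
    fix T assume T: "T \<in> Pow I"
    have "g T - g' T = (\<pi> - r d) * (h (insert d T) - h T)" by (simp add: g_def g'_def algebra_simps)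
    moreover have "\<bar>h (insert d T) - h T\<bar> \<le> 1" using h01[of T] h01[of "insert d T"] by auto
    ultimately have "\<bar>g T - g' T\<bar> \<le> \<bar>\<pi> - r d\<bar>" by (simp add: abs_mult mult_left_le)
    moreover have "bernoulli_weight r I T \<ge> 0"
      using T insert.prems by (intro bernoulli_weight_nonneg) auto
    ultimately show "\<bar>bernoulli_weight r I T * (g T - g' T)\<bar> \<le> bernoulli_weight r I T * \<bar>\<pi> - r d\<bar>"
      by (simp add: abs_mult mult_left_mono)
  qed
  also have "\<dots> = \<bar>\<pi> - r d\<bar>"
    using insert.hyps by (simp add: sum_bernoulli_weight flip: sum_distrib_right)
  finally show ?case using 3 insert.hyps unfolding 1 2 by (simp add: \<pi>_def)
qed

section \<open>Equal sums and divisors of equal degree\<close>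

text \<open>Disjointness lets a union be split again into its traces on \<open>S\<close> and
  \<open>T\<close>, so pairs inject into unions while sums add.\<close>

lemma card_subset_sums_Un:
  fixes S T :: "nat set"
  assumes "finite S" "finite T" "S \<inter> T = {}"
  shows "card {A. A \<subseteq> S \<and> \<Sum>A = s} * card {A. A \<subseteq> T \<and> \<Sum>A = t} \<le> card {A. A \<subseteq> S \<union> T \<and> \<Sum>A = s + t}"
proof -
  let ?X = "{A. A \<subseteq> S \<and> \<Sum>A = s}" and ?Y = "{A. A \<subseteq> T \<and> \<Sum>A = t}"
  have "card (?X \<times> ?Y) \<le> card {A. A \<subseteq> S \<union> T \<and> \<Sum>A = s + t}"
  proof (rule card_inj_on_le[of "\<lambda>(A, B). A \<union> B"])
    show "inj_on (\<lambda>(A, B). A \<union> B) (?X \<times> ?Y)"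
    proof (rule inj_on_inverseI[where g = "\<lambda>C. (C \<inter> S, C \<inter> T)"])
    qed (use assms in auto)
    show "(\<lambda>(A, B). A \<union> B) ` (?X \<times> ?Y) \<subseteq> {A. A \<subseteq> S \<union> T \<and> \<Sum>A = s + t}"
    proof clarify
      fix A B assume AB: "A \<subseteq> S" "B \<subseteq> T" and "s = \<Sum>A" "t = \<Sum>B"
      have "finite A" "finite B" "A \<inter> B = {}" using AB assms finite_subset by auto
      then show "A \<union> B \<subseteq> S \<union> T \<and> \<Sum>(A \<union> B) = \<Sum>A + \<Sum>B"
        using AB by (auto simp: sum.union_disjoint)
    qed
    show "finite {A. A \<subseteq> S \<union> T \<and> \<Sum>A = s + t}" using assms by simp
  qed
  then show ?thesis by (simp add: card_cartesian_product)
qed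

lemma card_subset_sums_UN:
  fixes S :: "'i \<Rightarrow> nat set"
  assumes "finite G" "\<And>j. j \<in> G \<Longrightarrow> finite (S j)" "disjoint_family_on S G"
    and "\<And>j. j \<in> G \<Longrightarrow> k \<le> card {A. A \<subseteq> S j \<and> \<Sum>A = s j}"
  shows "k ^ card G \<le> card {A. A \<subseteq> (\<Union>j\<in>G. S j) \<and> \<Sum>A = (\<Sum>j\<in>G. s j)}"
  using assms
proof (induction G rule: finite_induct)
  case empty
  have "{A. A \<subseteq> (\<Union>j\<in>{}. S j) \<and> \<Sum>A = (\<Sum>j\<in>{}. s j)} = {{}}" by auto
  then show ?case by simp
next
  case (insert j G)
  have disj: "S j \<inter> (\<Union>j\<in>G. S j) = {}"
    using insert.prems(2) insert.hyps by (fastforce simp: disjoint_family_on_def)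
  have "disjoint_family_on S G" using insert.prems(2) by (auto simp: disjoint_family_on_def)
  then have "k ^ card G \<le> card {A. A \<subseteq> (\<Union>j\<in>G. S j) \<and> \<Sum>A = (\<Sum>j\<in>G. s j)}"
    using insert.prems by (intro insert.IH) auto
  then have "k * k ^ card G \<le> card {A. A \<subseteq> S j \<and> \<Sum>A = s j} *
      card {A. A \<subseteq> (\<Union>j\<in>G. S j) \<and> \<Sum>A = (\<Sum>j\<in>G. s j)}"
    using insert.prems(3)[of j] by (intro mult_le_mono) auto
  also have "\<dots> \<le> card {A. A \<subseteq> S j \<union> (\<Union>j\<in>G. S j) \<and> \<Sum>A = s j + (\<Sum>j\<in>G. s j)}"
    using insert.prems insert.hyps disj by (intro card_subset_sums_Un) auto
  finally show ?case using insert.hyps by simp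
qed

lemma equal_sums_card:
  assumes "equal_sums k S" "finite S" "k \<ge> 1"
  shows "\<exists>s. k \<le> card {A. A \<subseteq> S \<and> \<Sum>A = s}"
proof -
  obtain A where A: "inj_on A {1..k}" "\<And>i. i \<in> {1..k} \<Longrightarrow> A i \<subseteq> S"
    "\<And>i j. i \<in> {1..k} \<Longrightarrow> j \<in> {1..k} \<Longrightarrow> \<Sum>(A i) = \<Sum>(A j)"
    using assms(1) unfolding equal_sums_def by blast
  have "A ` {1..k} \<subseteq> {B. B \<subseteq> S \<and> \<Sum>B = \<Sum>(A 1)}"
  proof
    fix B assume "B \<in> A ` {1..k}"
    then obtain i where i: "i \<in> {1..k}" "B = A i" by auto
    then show "B \<in> {B. B \<subseteq> S \<and> \<Sum>B = \<Sum>(A 1)}"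
      using A(2)[of i] A(3)[of i 1] assms(3) by simp
  qed
  then have "card (A ` {1..k}) \<le> card {B. B \<subseteq> S \<and> \<Sum>B = \<Sum>(A 1)}"
    using assms(2) by (intro card_mono) auto
  then show ?thesis using card_image[OF A(1)] by auto
qed

text \<open>Divisors counted by \<open>Delta\<close> need not be monic, so each is a scalar times a
  monic polynomial. The polynomial \<open>0\<close> has degree \<open>0\<close> by convention and is
  added by hand.\<close>

lemma finite_degree_eq: "finite {g :: 'a::{finite,field} poly. degree g = s}"
proof (rule finite_subset)
  show "{g :: 'a poly. degree g = s} \<subseteq> insert 0 ((\<lambda>(c, m). smult c m) ` (UNIV \<times> monic_polys s))"
  proof
    fix g :: "'a poly" assume g: "g \<in> {g. degree g = s}"
    show "g \<in> insert 0 ((\<lambda>(c, m). smult c m) ` (UNIV \<times> monic_polys s))"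
    proof (cases "g = 0")
      case False
      have "g = smult (lead_coeff g) (smult (inverse (lead_coeff g)) g)" using False by simp
      moreover have "smult (inverse (lead_coeff g)) g \<in> monic_polys s"
        using False g leading_coeff_neq_0[of g] by (auto simp: monic_polys_def)
      ultimately show ?thesis by (intro insertI2 image_eqI[of _ _ "(lead_coeff g, smult (inverse (lead_coeff g)) g)"]) auto
    qed simp
  qed
qed (simp add: finite_monic_polys)

text \<open>A set and not a multiset: a degree counts once however many irreducible factors have it,
  as in a logarithmic random set.\<close>

definition irr_degrees :: "'a::{finite,field} poly \<Rightarrow> nat set" where
  "irr_degrees f = {d. \<exists>p\<in>irr d. p dvd f}"

text \<open>Fix one irreducible factor \<open>P d\<close> for each degree and send \<open>A\<close>
  to the product of the \<open>P d\<close> with \<open>d \<in> A\<close>. Its degree is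
  \<open>\<Sum>A\<close>, and \<open>A\<close> is recovered as the set of \<open>d\<close> for which
  \<open>P d\<close> divides it.\<close>

lemma card_subset_sums_le_Delta:
  fixes f :: "'a::{finite,field} poly"
  assumes "f \<noteq> 0" "finite S" "S \<subseteq> irr_degrees f"
  shows "card {A. A \<subseteq> S \<and> \<Sum>A = s} \<le> Delta f"
\<comment> \<open>An attained \<open>s\<close> is the degree of a divisor, hence at most
  \<open>degree f\<close> and inside the range of the maximum; for other \<open>s\<close> the count
  is \<open>0\<close>.\<close>
proof (cases "{A. A \<subseteq> S \<and> \<Sum>A = s} = {}")
  case False
  have "\<forall>d\<in>S. \<exists>p. p \<in> irr d \<and> p dvd f" using assms by (auto simp: irr_degrees_def)
  then obtain P where P: "\<And>d. d \<in> S \<Longrightarrow> P d \<in> irr d" "\<And>d. d \<in> S \<Longrightarrow> P d dvd f"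
    by (auto simp: bchoice_iff)
  have deg: "degree (P d) = d" if "d \<in> S" for d using P(1)[OF that] by (simp add: irr_def)
  have inj: "inj_on P S" by (rule inj_on_inverseI[where g = degree]) (rule deg)
  let ?g = "\<lambda>A. \<Prod>(P ` A)"
  have irrU: "P ` A \<subseteq> (\<Union>d. irr d)" if "A \<subseteq> S" for A using P that by auto
  have fin: "finite A" if "A \<subseteq> S" for A using that assms finite_subset by blast
  have dvd: "?g A dvd f" and degg: "degree (?g A) = \<Sum>A" if A: "A \<subseteq> S" for A
  proof -
    show "?g A dvd f"
      using prod_irr_dvd_iff[of "P ` A" f] irrU[OF A] fin[OF A] P A by auto
    have "degree (?g A) = (\<Sum>d\<in>A. degree (P d))"
      using degree_prod_irr[OF _ irrU[OF A]] fin[OF A] inj_on_subset[OF inj A]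
      by (simp add: sum.reindex)
    also have "\<dots> = \<Sum>A" using deg A by (intro sum.cong) auto
    finally show "degree (?g A) = \<Sum>A" .
  qed
  have mem: "d \<in> A \<longleftrightarrow> P d dvd ?g A" if A: "A \<subseteq> S" and d: "d \<in> S" for A d
  proof
    show "P d dvd ?g A" if "d \<in> A" using that fin[OF A] by (intro dvd_prodI) auto
    assume "P d dvd ?g A"
    then have "P d \<in> P ` A" using irr_dvd_prod[OF P(1)[OF d] _ irrU[OF A]] fin[OF A] by simp
    then show "d \<in> A" using inj A d by (auto dest: inj_onD)
  qed
  have "card {A. A \<subseteq> S \<and> \<Sum>A = s} \<le> card {g. g dvd f \<and> degree g = s}"
  proof (rule card_inj_on_le[of ?g])
    show "inj_on ?g {A. A \<subseteq> S \<and> \<Sum>A = s}"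
    proof (rule inj_on_inverseI[where g = "\<lambda>g. {d\<in>S. P d dvd g}"])
      fix A assume "A \<in> {A. A \<subseteq> S \<and> \<Sum>A = s}"
      then show "{d\<in>S. P d dvd ?g A} = A" using mem[of A] by auto
    qed
    show "finite {g. g dvd f \<and> degree g = s}"
      by (rule finite_subset[OF _ finite_degree_eq[of s]]) auto
  qed (use dvd degg in auto)
  also have "\<dots> \<le> Delta f"
    unfolding Delta_def
  proof (rule Max_ge)
    obtain A where "A \<subseteq> S" "\<Sum>A = s" using False by auto
    then have "s \<le> degree f" using dvd_imp_degree_le[OF dvd assms(1)] degg by auto
    then show "card {g. g dvd f \<and> degree g = s} \<in> (\<lambda>r. card {g. g dvd f \<and> degree g = r}) ` {..degree f}"
      by auto
  qed simp
  finally show ?thesis .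
qed (simp only: card.empty)

lemma Delta_ge_power:
  fixes f :: "'a::{finite,field} poly" and I :: "'i \<Rightarrow> nat set"
  assumes "f \<noteq> 0" "k \<ge> 1" "finite G" "\<And>j. j \<in> G \<Longrightarrow> finite (I j)" "disjoint_family_on I G"
    and "\<And>j. j \<in> G \<Longrightarrow> equal_sums k (irr_degrees f \<inter> I j)"
  shows "k ^ card G \<le> Delta f"
proof -
  define S where "S j = irr_degrees f \<inter> I j" for j
  have fin: "\<And>j. j \<in> G \<Longrightarrow> finite (S j)" using assms by (auto simp: S_def)
  have "\<forall>j\<in>G. \<exists>s. k \<le> card {A. A \<subseteq> S j \<and> \<Sum>A = s}"
    using equal_sums_card assms(2,6) fin unfolding S_def by blast
  then obtain s where s: "\<And>j. j \<in> G \<Longrightarrow> k \<le> card {A. A \<subseteq> S j \<and> \<Sum>A = s j}"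
    by (auto simp: bchoice_iff)
  have "disjoint_family_on S G"
    using assms(5) by (fastforce simp: disjoint_family_on_def S_def)
  then have "k ^ card G \<le> card {A. A \<subseteq> (\<Union>j\<in>G. S j) \<and> \<Sum>A = (\<Sum>j\<in>G. s j)}"
    using assms(3) fin s by (intro card_subset_sums_UN)
  also have "\<dots> \<le> Delta f"
    using assms fin by (intro card_subset_sums_le_Delta) (auto simp: S_def)
  finally show ?thesis .
qed

section \<open>Factor degrees versus logarithmic random sets\<close>

lemma (in prob_space) sum_prob_eq:
  assumes "finite J" "\<And>\<omega>. \<omega> \<in> space M \<Longrightarrow> X \<omega> \<subseteq> J"
    and "\<And>R. R \<subseteq> J \<Longrightarrow> {\<omega>\<in>space M. X \<omega> = R} \<in> events"
  shows "(\<Sum>R\<in>{R\<in>Pow J. P R}. prob {\<omega>\<in>space M. X \<omega> = R}) = prob {\<omega>\<in>space M. P (X \<omega>)}"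
proof -
  have "{\<omega>\<in>space M. P (X \<omega>)} = (\<Union>R\<in>{R\<in>Pow J. P R}. {\<omega>\<in>space M. X \<omega> = R})"
    using assms(2) by auto
  also have "prob \<dots> = (\<Sum>R\<in>{R\<in>Pow J. P R}. prob {\<omega>\<in>space M. X \<omega> = R})"
    using assms by (intro finite_measure_finite_Union) (auto simp: disjoint_family_on_def)
  finally show ?thesis ..
qed

text \<open>The event prescribes the finitely many coordinates in \<open>I\<close>, so it is a
  cylinder and its measure is the product of the marginals.\<close>

lemma prob_log_set_eq:
  assumes "finite I" "I \<subseteq> {1..}" "T \<subseteq> I"
  shows "\<P>(\<omega> in log_space. log_set \<omega> \<inter> I = T) = bernoulli_weight (\<lambda>d. 1 / real d) I T"
    and "{\<omega>\<in>space log_space. log_set \<omega> \<inter> I = T} \<in> sets log_space"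
proof -
  interpret P: product_prob_space "\<lambda>i. measure_pmf (bernoulli_pmf (1 / real i))" "{1::nat..}"
    by (simp add: product_prob_space_def product_sigma_finite_def product_prob_space_axioms_def
        measure_pmf.prob_space_axioms measure_pmf.sigma_finite_measure_axioms)
  have eq: "{\<omega>\<in>space log_space. log_set \<omega> \<inter> I = T} = {\<omega>\<in>space log_space. \<forall>i\<in>I. \<omega> i \<in> {i \<in> T}}"
    using assms by (auto simp: log_set_def)
  have "emeasure log_space {\<omega>\<in>space log_space. \<forall>i\<in>I. \<omega> i \<in> {i \<in> T}} =
      (\<Prod>i\<in>I. emeasure (measure_pmf (bernoulli_pmf (1 / real i))) {i \<in> T})"
    unfolding log_space_def using assms by (intro P.emeasure_PiM_Collect) auto
  also have "\<dots> = (\<Prod>i\<in>I. ennreal (if i \<in> T then 1 / real i else 1 - 1 / real i))"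
    using assms by (intro prod.cong) (auto simp: emeasure_pmf_single)
  also have "\<dots> = ennreal (\<Prod>i\<in>I. if i \<in> T then 1 / real i else 1 - 1 / real i)"
    using assms by (intro prod_ennreal) auto
  also have "(\<Prod>i\<in>I. if i \<in> T then 1 / real i else 1 - 1 / real i) = bernoulli_weight (\<lambda>d. 1 / real d) I T"
  proof -
    have "I \<inter> {i. i \<in> T} = T" "I \<inter> - {i. i \<in> T} = I - T" using assms by auto
    then show ?thesis using assms by (simp add: prod.If_cases bernoulli_weight_def)
  qed
  finally have *: "emeasure log_space {\<omega>\<in>space log_space. log_set \<omega> \<inter> I = T} =
      ennreal (bernoulli_weight (\<lambda>d. 1 / real d) I T)" unfolding eq .
  moreover have "bernoulli_weight (\<lambda>d. 1 / real d) I T \<ge> 0"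
    using assms by (intro bernoulli_weight_nonneg) (auto simp: field_simps subset_iff)
  ultimately show "\<P>(\<omega> in log_space. log_set \<omega> \<inter> I = T) = bernoulli_weight (\<lambda>d. 1 / real d) I T"
    by (simp add: measure_def)
  have "(\<lambda>\<omega>. \<omega> i) \<in> measurable log_space (count_space UNIV)" if "i \<in> I" for i
  proof -
    have "(\<lambda>\<omega>. \<omega> i) \<in> measurable log_space (measure_pmf (bernoulli_pmf (1 / real i)))"
      unfolding log_space_def using that assms by (intro measurable_component_singleton) auto
    then show ?thesis by simp
  qed
  then have "Measurable.pred log_space (\<lambda>\<omega>. \<forall>i\<in>I. \<omega> i \<in> {i \<in> T})"
    using assms(1) by (intro pred_intros_finite) auto
  then show "{\<omega>\<in>space log_space. log_set \<omega> \<inter> I = T} \<in> sets log_space"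
    unfolding eq by (simp add: pred_def)
qed

lemma prob_space_log_space: "prob_space log_space"
  unfolding log_space_def by (intro prob_space_PiM measure_pmf.prob_space_axioms)

lemma prob_log_set:
  assumes "finite I" "I \<subseteq> {1..}"
  shows "\<P>(\<omega> in log_space. P (log_set \<omega> \<inter> I)) =
    (\<Sum>T\<in>Pow I. bernoulli_weight (\<lambda>d. 1 / real d) I T * (if P T then 1 else 0))"
proof -
  interpret prob_space log_space by (rule prob_space_log_space)
  have "\<P>(\<omega> in log_space. P (log_set \<omega> \<inter> I)) =
      (\<Sum>T\<in>{T\<in>Pow I. P T}. \<P>(\<omega> in log_space. log_set \<omega> \<inter> I = T))"
    using assms prob_log_set_eq(2) by (intro sum_prob_eq[symmetric]) auto
  also have "\<dots> = (\<Sum>T\<in>{T\<in>Pow I. P T}. bernoulli_weight (\<lambda>d. 1 / real d) I T)"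
    using assms by (intro sum.cong prob_log_set_eq(1)) auto
  also have "\<dots> = (\<Sum>T\<in>Pow I. if P T then bernoulli_weight (\<lambda>d. 1 / real d) I T else 0)"
    using assms by (intro sum.inter_filter) auto
  finally show ?thesis by (simp add: if_distrib cong: if_cong)
qed

abbreviation poly_pmf :: "nat \<Rightarrow> 'a::{finite,field} poly pmf" where
  "poly_pmf n \<equiv> pmf_of_set (monic_polys n)"

text \<open>By the degree hypothesis \<open>prob_all_dvd\<close> gives all joint moments up to order
  \<open>L\<close> their independent values, so \<open>moment_comparison\<close> applies. What
  remains is \<open>3 ^ L\<close> times the elementary symmetric sum of order \<open>L\<close> in
  the numbers \<open>1 / q ^ degree p\<close>.\<close>

lemma prob_irr_divisors:
  fixes J :: "'a::{finite,field} poly set"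
  assumes J: "finite J" "J \<subseteq> (\<Union>d. irr d)" and L: "\<And>U. U \<subseteq> J \<Longrightarrow> card U \<le> L \<Longrightarrow> (\<Sum>p\<in>U. degree p) \<le> n"
    and h: "\<And>T. h T = (if P T then 1 else 0)"
  shows "\<bar>measure_pmf.prob (poly_pmf n) {f. P {p\<in>J. p dvd f}} -
      (\<Sum>R\<in>Pow J. bernoulli_weight (\<lambda>p. 1 / real CARD('a) ^ degree p) J R * h R)\<bar> \<le>
    4 * exp (6 * (\<Sum>p\<in>J. 1 / real CARD('a) ^ degree p)) / 2 ^ L"
proof -
  let ?q = "\<lambda>p :: 'a poly. 1 / real CARD('a) ^ degree p"
  define w where "w R = measure_pmf.prob (poly_pmf n) {f. {p\<in>J. p dvd f} = R}" for R
  have q1: "real CARD('a) \<ge> 1" by (simp add: Suc_leI)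
  have q01: "?q p \<in> {0..1}" for p using q1 by (auto simp: field_simps intro: one_le_power)
  have w: "(\<Sum>R\<in>{R\<in>Pow J. Q R}. w R) = measure_pmf.prob (poly_pmf n) {f. Q {p\<in>J. p dvd f}}" for Q
    using measure_pmf.sum_prob_eq[OF J(1), of "poly_pmf n" "\<lambda>f. {p\<in>J. p dvd f}" Q]
    by (simp add: w_def)
  have moments: "(\<Sum>R\<in>{R\<in>Pow J. U \<subseteq> R}. w R) =
      (\<Sum>R\<in>{R\<in>Pow J. U \<subseteq> R}. bernoulli_weight ?q J R)" if U: "U \<subseteq> J" "card U \<le> L" for U
  proof -
    have "{f. U \<subseteq> {p\<in>J. p dvd f}} = {f. \<forall>p\<in>U. p dvd f}" using U by auto
    then have "(\<Sum>R\<in>{R\<in>Pow J. U \<subseteq> R}. w R) = (\<Prod>p\<in>U. ?q p)"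
      using prob_all_dvd[of U n] U J L[OF U] finite_subset[OF U(1) J(1)] unfolding w by auto
    then show ?thesis using sum_bernoulli_weight_superset[OF J(1) U(1)] by simp
  qed
  have *: "\<bar>(\<Sum>R\<in>Pow J. w R * h R) - (\<Sum>R\<in>Pow J. bernoulli_weight ?q J R * h R)\<bar> \<le>
      2 * (3 ^ L + 1) * (\<Sum>U\<in>{U\<in>Pow J. card U = L}. \<Sum>R\<in>{R\<in>Pow J. U \<subseteq> R}. bernoulli_weight ?q J R)"
    using moments by (intro moment_comparison J bernoulli_weight_nonneg q01) (auto simp: w_def h)
  have "(\<Sum>U\<in>{U\<in>Pow J. card U = L}. \<Sum>R\<in>{R\<in>Pow J. U \<subseteq> R}. bernoulli_weight ?q J R) =
      (\<Sum>U\<in>{U\<in>Pow J. card U = L}. \<Prod>p\<in>U. ?q p)"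
    using J by (intro sum.cong sum_bernoulli_weight_superset) auto
  also have "\<dots> = (\<Sum>U\<in>{U\<in>Pow J. card U = L}. (\<Prod>p\<in>U. 6 * ?q p) / 6 ^ L)"
    by (rule sum.cong[OF refl], subst prod.distrib) auto
  also have "\<dots> \<le> (\<Sum>U\<in>Pow J. (\<Prod>p\<in>U. 6 * ?q p) / 6 ^ L)"
    using J by (intro sum_mono2) (auto intro!: prod_nonneg divide_nonneg_nonneg)
  also have "\<dots> = (\<Prod>p\<in>J. 6 * ?q p + 1) / 6 ^ L"
    using J by (simp add: prod_add sum_divide_distrib)
  also have "\<dots> \<le> (\<Prod>p\<in>J. exp (6 * ?q p)) / 6 ^ L"
    using exp_ge_add_one_self by (intro divide_right_mono prod_mono) (auto simp: add.commute)
  also have "\<dots> = exp (6 * (\<Sum>p\<in>J. ?q p)) / 6 ^ L"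
    using J by (simp add: exp_sum sum_distrib_left)
  finally have "\<bar>(\<Sum>R\<in>Pow J. w R * h R) - (\<Sum>R\<in>Pow J. bernoulli_weight ?q J R * h R)\<bar> \<le>
      2 * (3 ^ L + 1) * (exp (6 * (\<Sum>p\<in>J. ?q p)) / 6 ^ L)"
    by (intro order_trans[OF * mult_left_mono]) auto
  also have "\<dots> \<le> (4 * 3 ^ L) * (exp (6 * (\<Sum>p\<in>J. ?q p)) / 6 ^ L)"
    by (intro mult_right_mono) auto
  also have "\<dots> = 4 * exp (6 * (\<Sum>p\<in>J. ?q p)) / 2 ^ L"
    using power_mult_distrib[of "2::real" 3 L] by simp
  also have "(\<Sum>R\<in>Pow J. w R * h R) = (\<Sum>R\<in>{R\<in>Pow J. P R}. w R)"
    using J by (subst sum.inter_filter) (auto simp: h intro!: sum.cong)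
  finally show ?thesis unfolding w .
qed

text \<open>Two replacements, one per error term: divisibility by irreducibles becomes independent
  choice, and then the event that degree \<open>d\<close> occurs is given probability
  \<open>1 / d\<close>. The condition \<open>N * L \<le> n\<close> ensures that any \<open>L\<close>
  irreducibles of degree at most \<open>N\<close> fit into degree \<open>n\<close>.\<close>

lemma prob_irr_degrees:
  fixes I :: "nat set"
  assumes I: "I \<subseteq> {1..N}" and N: "N * L \<le> n" "N \<ge> 1"
  shows "\<bar>measure_pmf.prob (poly_pmf n) {f :: 'a::{finite,field} poly. P (irr_degrees f \<inter> I)} -
      \<P>(\<omega> in log_space. P (log_set \<omega> \<inter> I))\<bar> \<le>
    4 * exp (6 * (1 + ln (real N))) / 2 ^ L +
    (\<Sum>d\<in>I. \<bar>1 - (1 - 1 / real CARD('a) ^ d) ^ card (irr d :: 'a poly set) - 1 / real d\<bar>)"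
proof -
  let ?q = "\<lambda>p :: 'a poly. 1 / real CARD('a) ^ degree p"
  let ?J = "\<Union>d\<in>I. irr d :: 'a poly set"
  define h :: "nat set \<Rightarrow> real" where "h T = (if P T then 1 else 0)" for T
  define deg where "deg R = {d\<in>I. R \<inter> irr d \<noteq> {}}" for R :: "'a poly set"
  have fin: "finite I" "I \<subseteq> {1..}" using I finite_subset by auto
  have q1: "real CARD('a) \<ge> 1" by (simp add: Suc_leI)
  have degs: "irr_degrees f \<inter> I = deg {p\<in>?J. p dvd f}" for f
    by (auto simp: irr_degrees_def deg_def)
  have disj: "disjoint_family_on (irr :: nat \<Rightarrow> 'a poly set) I"
    by (auto simp: disjoint_family_on_def irr_def)
  have "(\<Sum>p\<in>?J. ?q p) = (\<Sum>d\<in>I. \<Sum>p\<in>irr d. ?q p)"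
    using fin disj by (intro sum.UNION_disjoint) (auto simp: disjoint_family_on_def)
  also have "\<dots> = (\<Sum>d\<in>I. \<Sum>p\<in>(irr d :: 'a poly set). 1 / real CARD('a) ^ d)"
    by (intro sum.cong) (auto simp: irr_def)
  also have "\<dots> = (\<Sum>d\<in>I. expected_irr TYPE('a) d)" by (simp add: expected_irr_def)
  also have "\<dots> \<le> (\<Sum>d\<in>I. 1 / real d)"
    using fin by (intro sum_mono expected_irr_le) auto
  also have "\<dots> \<le> (\<Sum>d\<in>{1..N}. 1 / real d)" using I by (intro sum_mono2) auto
  also have "\<dots> = harm N" by (simp add: harm_def inverse_eq_divide)
  \<comment> \<open>\<open>harm N - ln N\<close> is decreasing and equals \<open>1\<close> at
    \<open>N = 1\<close>.\<close>
  also have "\<dots> \<le> 1 + ln (real N)" using euler_mascheroni_sequence_decreasing[of 1 N] N by (simp add: harm_def)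
  finally have mu: "(\<Sum>p\<in>?J. ?q p) \<le> 1 + ln (real N)" .
  have "\<bar>measure_pmf.prob (poly_pmf n) {f. P (deg {p\<in>?J. p dvd f})} -
      (\<Sum>R\<in>Pow ?J. bernoulli_weight ?q ?J R * h (deg R))\<bar> \<le>
      4 * exp (6 * (\<Sum>p\<in>?J. ?q p)) / 2 ^ L"
  proof (rule prob_irr_divisors)
    fix U assume U: "U \<subseteq> ?J" "card U \<le> L"
    have "(\<Sum>p\<in>U. degree p) \<le> (\<Sum>p\<in>U. N)"
    proof (rule sum_mono)
      fix p assume "p \<in> U"
      then obtain d where "d \<in> I" "p \<in> irr d" using U by auto
      then show "degree p \<le> N" using I by (auto simp: irr_def)
    qed
    also have "\<dots> \<le> N * L" using U by simp
    finally show "(\<Sum>p\<in>U. degree p) \<le> n" using N by simp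
  qed (use fin in \<open>auto simp: h_def\<close>)
  also have "\<dots> \<le> 4 * exp (6 * (1 + ln (real N))) / 2 ^ L"
    using mu by (intro divide_right_mono) auto
  finally have 1: "\<bar>measure_pmf.prob (poly_pmf n) {f. P (deg {p\<in>?J. p dvd f})} -
      (\<Sum>R\<in>Pow ?J. bernoulli_weight ?q ?J R * h (deg R))\<bar> \<le> 4 * exp (6 * (1 + ln (real N))) / 2 ^ L" .
  have "\<bar>(\<Sum>R\<in>Pow ?J. bernoulli_weight ?q ?J R * h (deg R)) -
      (\<Sum>T\<in>Pow I. bernoulli_weight (\<lambda>d. 1 / real d) I T * h T)\<bar> \<le>
      (\<Sum>d\<in>I. \<bar>1 - (\<Prod>p\<in>(irr d :: 'a poly set). 1 - ?q p) - 1 / real d\<bar>)"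
    unfolding deg_def using fin disj q1
    by (intro bernoulli_weight_blocks) (auto simp: h_def field_simps subset_iff intro: one_le_power)
  also have "\<dots> = (\<Sum>d\<in>I. \<bar>1 - (\<Prod>p\<in>(irr d :: 'a poly set). 1 - 1 / real CARD('a) ^ d) - 1 / real d\<bar>)"
    by (intro sum.cong arg_cong[of _ _ abs] arg_cong2[of _ _ _ _ "(-)"] prod.cong refl) (auto simp: irr_def)
  finally have 2: "\<bar>(\<Sum>R\<in>Pow ?J. bernoulli_weight ?q ?J R * h (deg R)) -
      (\<Sum>T\<in>Pow I. bernoulli_weight (\<lambda>d. 1 / real d) I T * h T)\<bar> \<le>
      (\<Sum>d\<in>I. \<bar>1 - (1 - 1 / real CARD('a) ^ d) ^ card (irr d :: 'a poly set) - 1 / real d\<bar>)"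
    by simp
  have 3: "\<P>(\<omega> in log_space. P (log_set \<omega> \<inter> I)) =
      (\<Sum>T\<in>Pow I. bernoulli_weight (\<lambda>d. 1 / real d) I T * h T)"
    using prob_log_set[OF fin] by (simp add: h_def)
  show ?thesis using 1 2 3 unfolding degs by linarith
qed

text \<open>\<open>(1 - t + t^2) * (1 + t) = 1 + t^3 \<ge> 1\<close>, combined with
  \<open>1 + t \<le> exp t\<close>.\<close>

lemma exp_minus_le:
  fixes t :: real
  assumes "t \<ge> 0"
  shows "exp (- t) \<le> 1 - t + t\<^sup>2"
proof -
  have "1 \<le> (1 - t + t\<^sup>2) * (1 + t)" using assms by (simp add: algebra_simps power2_eq_square)
  also have "\<dots> \<le> (1 - t + t\<^sup>2) * exp t"
  proof (rule mult_left_mono)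
    show "0 \<le> 1 - t + t\<^sup>2" using assms zero_le_power2[of "t - 1/2"]
      by (simp add: power2_eq_square algebra_simps)
  qed simp
  finally show ?thesis by (simp add: exp_minus field_simps)
qed

text \<open>With \<open>t\<close> the expected number of chosen factors of degree \<open>d\<close>,
  the probability of choosing none lies between \<open>1 - t\<close> and
  \<open>exp (- t) \<le> 1 - t + t^2\<close>. Both \<open>t^2\<close> and the distance from
  \<open>t\<close> to \<open>1 / d\<close> are at most \<open>1 / d^2\<close>.\<close>

lemma prob_degree_present:
  "\<forall>\<^sub>F d in sequentially.
     \<bar>1 - (1 - 1 / real CARD('a) ^ d) ^ card (irr d :: 'a::{finite,field} poly set) - 1 / real d\<bar> \<le> 2 / real d ^ 2"
  using expected_irr_ge[where 'a='a] eventually_ge_at_top[of 1]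
proof eventually_elim
  case (elim d)
  let ?y = "1 / real CARD('a) ^ d" and ?N = "card (irr d :: 'a poly set)"
  define t where "t = expected_irr TYPE('a) d"
  have t: "t = real ?N * ?y" by (simp add: t_def expected_irr_def)
  have q1: "real CARD('a) \<ge> 1" by (simp add: Suc_leI)
  then have y: "0 \<le> ?y" "?y \<le> 1" by (auto simp: field_simps intro: one_le_power)
  have t0: "0 \<le> t" by (simp add: t_def expected_irr_def)
  have t1: "t \<le> 1 / real d" unfolding t_def using elim by (intro expected_irr_le)
  have "t\<^sup>2 \<le> (1 / real d)\<^sup>2" using t0 t1 by (intro power_mono)
  then have t2: "t\<^sup>2 \<le> 1 / real d ^ 2" by (simp add: power_one_over)
  have "1 - t \<le> (1 - ?y) ^ ?N"
    using Bernoulli_inequality[of "- ?y" ?N] y by (simp add: t)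
  moreover have "(1 - ?y) ^ ?N \<le> exp (- ?y) ^ ?N"
    using y exp_ge_add_one_self[of "- ?y"] by (intro power_mono) auto
  moreover have "exp (- ?y) ^ ?N = exp (- t)"
    by (simp add: t exp_of_nat_mult[symmetric])
  moreover have "exp (- t) \<le> 1 - t + t\<^sup>2" by (rule exp_minus_le[OF t0])
  ultimately show ?case using t1 t2 elim(1) unfolding t_def[symmetric] by (simp add: abs_le_iff)
qed

text \<open>Take \<open>N\<close> and \<open>L\<close> both equal to the integer part of
  \<open>D\<close>, so \<open>N * L \<le> D^2 \<le> n\<close>. The first error is a power of
  \<open>N\<close> against \<open>2 ^ N\<close>; the second is a tail of a convergent series,
  starting at \<open>D powr c\<close>, which tends to infinity. Neither bound involves
  \<open>n\<close>, so one threshold for \<open>D\<close> serves all \<open>n\<close>.\<close>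

lemma prob_irr_degrees_tendsto:
  fixes P :: "nat set \<Rightarrow> bool"
  assumes c: "c > 0" and e: "e > 0"
  shows "\<forall>\<^sub>F D in at_top. \<forall>n. D ^ 2 \<le> real n \<longrightarrow>
    \<bar>measure_pmf.prob (poly_pmf n) {f :: 'a::{finite,field} poly. P (irr_degrees f \<inter> {a. real a \<in> {D powr c..D}})} -
      \<P>(\<omega> in log_space. P (log_set \<omega> \<inter> {a. real a \<in> {D powr c..D}}))\<bar> \<le> e"
proof -
  let ?err = "\<lambda>d. \<bar>1 - (1 - 1 / real CARD('a) ^ d) ^ card (irr d :: 'a poly set) - 1 / real d\<bar>"
  have "((\<lambda>N::nat. 4 * exp (6 * (1 + ln (real N))) / 2 ^ N) \<longlongrightarrow> 0) sequentially"
    by real_asymp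
  then have *: "((\<lambda>D::real. 4 * exp (6 * (1 + ln (real (nat \<lfloor>D\<rfloor>)))) / 2 ^ nat \<lfloor>D\<rfloor>) \<longlongrightarrow> 0) at_top"
    by (rule filterlim_compose[OF _ filterlim_compose[OF filterlim_nat_sequentially filterlim_floor_sequentially]])
  have ev1: "\<forall>\<^sub>F D::real in at_top. 4 * exp (6 * (1 + ln (real (nat \<lfloor>D\<rfloor>)))) / 2 ^ nat \<lfloor>D\<rfloor> < e / 2"
    by (rule order_tendstoD(2)[OF *]) (use e in simp)
  obtain d0 where d0: "\<And>d. d \<ge> d0 \<Longrightarrow> ?err d \<le> 2 / real d ^ 2"
    using prob_degree_present[where 'a='a] unfolding eventually_sequentially by blast
  have "summable (\<lambda>d. 1 / real d ^ 2)" using inverse_power_summable[of 2, where 'a=real]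
    by (simp add: inverse_eq_divide)
  then have "summable (\<lambda>d. 2 / real d ^ 2)" using summable_mult[of _ 2] by fastforce
  then obtain M where M: "\<And>m n. m \<ge> M \<Longrightarrow> \<bar>\<Sum>d\<in>{m..<n}. 2 / real d ^ 2\<bar> < e / 2"
    using e unfolding summable_Cauchy by (metis half_gt_zero real_norm_def)
  have "filterlim (\<lambda>D::real. D powr c) at_top at_top" using c by real_asymp
  then have ev2: "\<forall>\<^sub>F D in at_top. real (max M d0) \<le> D powr c"
    unfolding filterlim_at_top by blast
  show ?thesis
    using ev1 ev2 eventually_ge_at_top[of 1]
  proof eventually_elim
    case (elim D)
    let ?I = "{a. real a \<in> {D powr c..D}}" and ?N = "nat \<lfloor>D\<rfloor>"
    have Dc: "D powr c \<ge> 1" using elim c ge_one_powr_ge_zero[of D c] by simp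
    have I: "?I \<subseteq> {1..?N}"
    proof
      fix a assume "a \<in> ?I"
      then have "1 \<le> real a" "real a \<le> D" using Dc by auto
      then show "a \<in> {1..?N}" by (auto simp: le_nat_floor)
    qed
    have I': "?I \<subseteq> {max M d0..<Suc ?N}"
    proof
      fix a assume a: "a \<in> ?I"
      then have "real (max M d0) \<le> real a" using elim(2) by auto
      then show "a \<in> {max M d0..<Suc ?N}" using I a by auto
    qed
    have "(\<Sum>d\<in>?I. ?err d) \<le> (\<Sum>d\<in>?I. 2 / real d ^ 2)"
      using I' by (intro sum_mono d0) auto
    also have "\<dots> \<le> (\<Sum>d\<in>{max M d0..<Suc ?N}. 2 / real d ^ 2)"
      using I' by (intro sum_mono2) auto
    also have "\<dots> < e / 2" using M[of "max M d0" "Suc ?N"] by linarith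
    finally have err: "(\<Sum>d\<in>?I. ?err d) < e / 2" .
    have N: "real ?N \<le> D" "?N \<ge> 1" using elim(3) by (auto simp: le_nat_floor)
    show ?case
    proof (intro allI impI)
      fix n assume n: "D ^ 2 \<le> real n"
      have "real (?N * ?N) \<le> D ^ 2" using N elim(3) by (simp add: power2_eq_square mult_mono)
      then have "?N * ?N \<le> n" using n by linarith
      then show "\<bar>measure_pmf.prob (poly_pmf n) {f :: 'a poly. P (irr_degrees f \<inter> ?I)} -
          \<P>(\<omega> in log_space. P (log_set \<omega> \<inter> ?I))\<bar> \<le> e"
        using prob_irr_degrees[OF I _ N(2), of ?N n P, where 'a='a] err elim(1) by linarith
    qed
  qed
qed

lemma prob_equal_sums:
  assumes c: "c > 0" and adm: "admissible k c" and e: "e > 0"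
  shows "\<forall>\<^sub>F D in at_top. \<forall>n. D ^ 2 \<le> real n \<longrightarrow>
    measure_pmf.prob (poly_pmf n)
      {f :: 'a::{finite,field} poly. equal_sums k (irr_degrees f \<inter> {a. real a \<in> {D powr c..D}})} \<ge> 1 - e"
proof -
  have "\<forall>\<^sub>F D in at_top. 1 - e / 2 <
      \<P>(\<omega> in log_space. equal_sums k (log_set \<omega> \<inter> {a. real a \<in> {D powr c..D}}))"
    using adm e unfolding admissible_def by (intro order_tendstoD) auto
  moreover have "\<forall>\<^sub>F D in at_top. \<forall>n. D ^ 2 \<le> real n \<longrightarrow>
    \<bar>measure_pmf.prob (poly_pmf n) {f :: 'a poly. equal_sums k (irr_degrees f \<inter> {a. real a \<in> {D powr c..D}})} -
      \<P>(\<omega> in log_space. equal_sums k (log_set \<omega> \<inter> {a. real a \<in> {D powr c..D}}))\<bar> \<le> e / 2"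
    using e by (intro prob_irr_degrees_tendsto c) auto
  ultimately show ?thesis
  proof eventually_elim
    case (elim D)
    show ?case
    proof (intro allI impI)
      fix n assume "D ^ 2 \<le> real n"
      then show "measure_pmf.prob (poly_pmf n)
          {f :: 'a poly. equal_sums k (irr_degrees f \<inter> {a. real a \<in> {D powr c..D}})} \<ge> 1 - e"
        using elim(1) elim(2)[rule_format, of n] by linarith
    qed
  qed
qed

section \<open>Combining the scales\<close>

text \<open>Markov's inequality for the number of indices satisfying \<open>Q\<close>. It involves
  only the individual probabilities, so different scales may be dependent.\<close>

lemma markov_count:
  fixes p :: "'x pmf"
  assumes "finite J" "t \<ge> 0"
  shows "t * measure_pmf.prob p {f. t \<le> real (card {j\<in>J. Q j f})} \<le> (\<Sum>j\<in>J. measure_pmf.prob p {f. Q j f})"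
proof -
  let ?S = "{f. t \<le> real (card {j\<in>J. Q j f})}"
  have int: "integrable (measure_pmf p) (indicator A :: 'x \<Rightarrow> real)" for A
    by (rule measure_pmf.integrable_const_bound[where B = 1]) (auto simp: indicator_def)
  have "t * measure_pmf.prob p ?S = measure_pmf.expectation p (\<lambda>f. t * indicator ?S f)"
    by simp
  also have "\<dots> \<le> measure_pmf.expectation p (\<lambda>f. \<Sum>j\<in>J. indicator {f. Q j f} f)"
  proof (rule integral_mono)
    fix f
    have "(\<Sum>j\<in>J. indicator {f. Q j f} f) = real (card {j\<in>J. Q j f})"
      using assms by (simp add: indicator_def sum.If_cases Int_def)
    then show "t * indicator ?S f \<le> (\<Sum>j\<in>J. indicator {f. Q j f} f)"
      by (simp add: indicator_def)
  qed (intro integrable_mult_right Bochner_Integration.integrable_sum int)+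
  also have "\<dots> = (\<Sum>j\<in>J. measure_pmf.prob p {f. Q j f})"
    using int by (simp add: Bochner_Integration.integral_sum)
  finally show ?thesis .
qed

text \<open>The scales \<open>D\<^sub>j = exp (b\<^sup>j)\<close> with \<open>b = exp \<beta>\<close> slightly larger than \<open>1/c\<close> make the intervals
  \<open>[D\<^sub>j\<^sup>c, D\<^sub>j]\<close> disjoint.\<close>
definition scale :: "real \<Rightarrow> nat \<Rightarrow> real" where
  "scale \<beta> j = exp (exp (\<beta> * real j))"

definition scale_interval :: "real \<Rightarrow> real \<Rightarrow> nat \<Rightarrow> nat set" where
  "scale_interval c \<beta> j = {a. real a \<in> {scale \<beta> j powr c..scale \<beta> j}}"

lemma finite_scale_interval [simp]: "finite (scale_interval c \<beta> j)"
proof (rule finite_subset)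
  show "scale_interval c \<beta> j \<subseteq> {..nat \<lfloor>scale \<beta> j\<rfloor>}"
    by (auto simp: scale_interval_def le_nat_floor)
qed simp

text \<open>On the logarithmic scale, for \<open>i < j\<close> the lower end
  \<open>c * exp (\<beta> * j)\<close> is at least \<open>c * exp \<beta>\<close> times
  \<open>exp (\<beta> * i)\<close>, the upper end of the earlier interval.\<close>

lemma disjoint_scale_intervals:
  assumes "\<beta> > 0" "c > 0" "c * exp \<beta> > 1"
  shows "disjoint_family_on (scale_interval c \<beta>) G"
proof -
  have less: "scale \<beta> i < scale \<beta> j powr c" if "i < j" for i j
  proof -
    have "exp (\<beta> * real i) < c * exp \<beta> * exp (\<beta> * real i)" using assms by simp
    also have "\<dots> = c * exp (\<beta> * real (Suc i))"
      by (simp add: exp_add[symmetric] algebra_simps)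
    also have "\<dots> \<le> c * exp (\<beta> * real j)" using that assms by simp
    finally show ?thesis by (simp add: scale_def powr_def)
  qed
  have "scale_interval c \<beta> i \<inter> scale_interval c \<beta> j = {}" if "i < j" for i j
    using less[OF that] by (force simp: scale_interval_def)
  then show ?thesis
    unfolding disjoint_family_on_def by (metis Int_commute linorder_neqE_nat)
qed

lemma Delta_pos: "f \<noteq> 0 \<Longrightarrow> Delta f \<ge> 1" for f :: "'a::{finite,field} poly"
  using Delta_ge_power[of f 1 "{} :: nat set" "\<lambda>_. {}"] by (simp add: disjoint_family_on_def)

text \<open>The growth condition on \<open>m\<close> says that the square of the largest scale is at
  most \<open>n\<close>. Scales from \<open>j0\<close> on fail with probability at most
  \<open>e\<close>; the fixed number of earlier ones are charged \<open>1\<close> each. The expected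
  number of failures is thus at most \<open>2 * e * m n\<close>, and Markov's inequality
  finishes.\<close>

lemma prob_many_good_scales:
  assumes k: "k \<ge> 2" and c: "c > 0" and adm: "admissible k c" and b: "\<beta> > 0"
    and \<delta>: "\<delta> > 0" and \<tau>: "\<tau> > 0" and m: "filterlim m at_top sequentially"
    and mle: "\<forall>\<^sub>F n in sequentially. exp (\<beta> * real (m n)) \<le> ln (real n) / 2"
  shows "\<forall>\<^sub>F n in sequentially. measure_pmf.prob (poly_pmf n)
    {f :: 'a::{finite,field} poly. \<delta> * real (m n) \<le>
      real (card {j\<in>{1..m n}. \<not> equal_sums k (irr_degrees f \<inter> scale_interval c \<beta> j)})} \<le> \<tau>"
proof -
  define e where "e = \<delta> * \<tau> / 2"
  have e: "e > 0" using \<delta> \<tau> by (simp add: e_def)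
  have "filterlim (scale \<beta>) at_top sequentially"
    unfolding scale_def using b by real_asymp
  then have "\<forall>\<^sub>F j in sequentially. \<forall>n. scale \<beta> j ^ 2 \<le> real n \<longrightarrow>
    measure_pmf.prob (poly_pmf n)
      {f :: 'a poly. equal_sums k (irr_degrees f \<inter> {a. real a \<in> {scale \<beta> j powr c..scale \<beta> j}})} \<ge> 1 - e"
    by (rule eventually_compose_filterlim[OF prob_equal_sums[OF c adm e]])
  then obtain j0 where j0: "\<And>j n. j \<ge> j0 \<Longrightarrow> scale \<beta> j ^ 2 \<le> real n \<Longrightarrow>
    measure_pmf.prob (poly_pmf n) {f :: 'a poly. equal_sums k (irr_degrees f \<inter> scale_interval c \<beta> j)} \<ge> 1 - e"
    unfolding eventually_sequentially scale_interval_def by blast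
  \<comment> \<open>Large enough for \<open>e * m n\<close> to cover the \<open>j0\<close> small
    scales; the \<open>+ 1\<close> makes \<open>m n\<close> positive.\<close>
  have "\<forall>\<^sub>F n in sequentially. nat \<lceil>real j0 / e\<rceil> + 1 \<le> m n"
    using m unfolding filterlim_at_top by blast
  then show ?thesis using mle eventually_gt_at_top[of 1]
  proof eventually_elim
    case (elim n)
    let ?Q = "\<lambda>j f. \<not> equal_sums k (irr_degrees (f :: 'a poly) \<inter> scale_interval c \<beta> j)"
    let ?pr = "measure_pmf.prob (poly_pmf n)"
    have mpos: "real (m n) > 0" "real j0 \<le> e * real (m n)"
    proof -
      have "real j0 / e \<le> real (nat \<lceil>real j0 / e\<rceil>)" by (simp add: real_nat_ceiling_ge)
      also have "\<dots> \<le> real (m n)" using elim(1) by linarith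
      finally show "real j0 \<le> e * real (m n)" using e by (simp add: field_simps)
      show "real (m n) > 0" using elim(1) by simp
    qed
    have bad: "?pr {f. ?Q j f} \<le> e + (if j < j0 then 1 else 0)" if j: "j \<in> {1..m n}" for j
    proof (cases "j < j0")
      case True
      have "?pr {f. ?Q j f} \<le> 1" by simp
      also have "\<dots> \<le> e + (if j < j0 then 1 else 0)" using True e by simp
      finally show ?thesis .
    next
      case False
      have "exp (\<beta> * real j) \<le> exp (\<beta> * real (m n))" using j b by simp
      then have "2 * exp (\<beta> * real j) \<le> ln (real n)" using elim(2) by linarith
      then have "exp (2 * exp (\<beta> * real j)) \<le> real n" using elim(3) by (simp add: ln_ge_iff)
      then have "scale \<beta> j ^ 2 \<le> real n" by (simp add: scale_def exp_double)
      then have "?pr {f. \<not> ?Q j f} \<ge> 1 - e" using j0[of j n] False by simp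
      moreover have "?pr {f. ?Q j f} = 1 - ?pr {f. \<not> ?Q j f}"
        using measure_pmf.prob_compl[of "{f. \<not> ?Q j f}" "poly_pmf n"]
        by (simp add: Compl_eq_Diff_UNIV[symmetric] Collect_neg_eq[symmetric])
      ultimately show ?thesis using False by simp
    qed
    have "\<delta> * real (m n) * ?pr {f. \<delta> * real (m n) \<le> real (card {j\<in>{1..m n}. ?Q j f})} \<le>
        (\<Sum>j\<in>{1..m n}. ?pr {f. ?Q j f})"
      using \<delta> by (intro markov_count) auto
    also have "\<dots> \<le> (\<Sum>j\<in>{1..m n}. e + (if j < j0 then 1 else 0))" by (intro sum_mono bad)
    also have "\<dots> = e * real (m n) + real (card ({1..m n} \<inter> {j. j < j0}))"
      by (simp add: sum.distrib sum.If_cases)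
    also have "card ({1..m n} \<inter> {j. j < j0}) \<le> card {..<j0}"
      by (intro card_mono) auto
    then have "e * real (m n) + real (card ({1..m n} \<inter> {j. j < j0})) \<le> e * real (m n) + real j0" by simp
    also have "\<dots> \<le> 2 * e * real (m n)" using mpos by simp
    also have "\<dots> = \<delta> * real (m n) * \<tau>" by (simp add: e_def)
    finally show ?case using mpos \<delta> by simp
  qed
qed

text \<open>About \<open>ln (ln n) / \<beta>\<close> scales fit below \<open>n\<close>. If at most a
  fraction \<open>\<delta>\<close> of them fail, \<open>Delta f\<close> is at least about
  \<open>ln n\<close> to the power \<open>(1 - \<delta>) * ln k / \<beta>\<close>, and
  \<open>\<beta>\<close>, \<open>\<delta>\<close> are chosen to make this exponent exceed
  \<open>\<eta>\<close>.\<close>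

lemma prob_Delta_ge:
  assumes k: "k \<ge> 2" and c: "0 < c" "c < 1" and adm: "admissible k c"
    and \<eta>: "\<eta> > 0" "\<eta> * ln (1 / c) < ln (real k)"
  shows "(\<lambda>n. measure_pmf.prob (poly_pmf n) {f :: 'a::{finite,field} poly. real (Delta f) \<ge> ln (real n) powr \<eta>}) \<longlonglongrightarrow> 1"
proof -
  have lnk: "ln (real k) > 0" using k by simp
  have "ln (1 / c) < ln (real k) / \<eta>" using \<eta> by (simp add: field_simps)
  \<comment> \<open>The lower bound on \<open>\<beta>\<close> makes the intervals disjoint; the
    upper bound keeps \<open>ln k / \<beta>\<close> above \<open>\<eta>\<close>.\<close>
  then obtain \<beta> where \<beta>: "ln (1 / c) < \<beta>" "\<beta> < ln (real k) / \<eta>" using dense by blast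
  have lnc: "ln (1 / c) > 0" using c by simp
  have b: "\<beta> > 0" using \<beta> lnc by linarith
  have "1 / c < exp \<beta>" using \<beta>(1) c by (metis exp_less_cancel_iff exp_ln zero_less_divide_1_iff)
  then have cb: "c * exp \<beta> > 1" using c by (simp add: field_simps)
  have "\<eta> * \<beta> / ln (real k) < 1" using \<beta> \<eta> lnk by (simp add: field_simps)
  then obtain \<delta>' where \<delta>': "\<eta> * \<beta> / ln (real k) < \<delta>'" "\<delta>' < 1" using dense by blast
  define \<delta> where "\<delta> = 1 - \<delta>'"
  have \<delta>: "\<delta> > 0" "\<eta> * \<beta> < (1 - \<delta>) * ln (real k)" using \<delta>' lnk by (auto simp: \<delta>_def field_simps)
  \<comment> \<open>The largest index whose scale has square at most \<open>n\<close>, that is,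
    \<open>exp (\<beta> * m n) \<le> ln n / 2\<close>.\<close>
  define m where "m n = nat \<lfloor>ln (ln (real n) / 2) / \<beta>\<rfloor>" for n
  have lim: "filterlim (\<lambda>n. ln (ln (real n) / 2) / \<beta>) at_top sequentially"
    using b by real_asymp
  have m: "filterlim m at_top sequentially"
    unfolding m_def
    by (rule filterlim_compose[OF filterlim_compose[OF filterlim_nat_sequentially filterlim_floor_sequentially] lim])
  have ev0: "\<forall>\<^sub>F n in sequentially. ln (ln (real n) / 2) / \<beta> \<ge> 0"
    using lim unfolding filterlim_at_top by blast
  have ev1: "\<forall>\<^sub>F n in sequentially. ln (real n) > 1" by real_asymp
  have mle: "\<forall>\<^sub>F n in sequentially. exp (\<beta> * real (m n)) \<le> ln (real n) / 2"
    using ev0 ev1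
  proof eventually_elim
    case (elim n)
    have "real (m n) \<le> ln (ln (real n) / 2) / \<beta>" using elim by (simp add: m_def)
    then have "\<beta> * real (m n) \<le> ln (ln (real n) / 2)" using b by (simp add: field_simps)
    then show ?case using elim by (simp add: ln_ge_iff)
  qed
  \<comment> \<open>The \<open>- 1\<close> pays for the floor in \<open>m\<close>. It and the factor
    \<open>1 / 2\<close> shift the right side by a bounded amount only, while the coefficient
    \<open>A\<close> of \<open>ln (ln n)\<close> exceeds \<open>\<eta>\<close>.\<close>
  have large: "\<forall>\<^sub>F n in sequentially.
      \<eta> * ln (ln (real n)) \<le> (1 - \<delta>) * ln (real k) * (ln (ln (real n) / 2) / \<beta> - 1)"
  proof -
    define A where "A = (1 - \<delta>) * ln (real k) / \<beta>"
    have A: "A > \<eta>" using \<delta> b by (simp add: A_def field_simps)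
    have "\<forall>\<^sub>F n in sequentially. \<eta> * ln (ln (real n)) \<le> A * ln (ln (real n) / 2) - A * \<beta>"
      using A b \<eta> by real_asymp
    then show ?thesis
    proof eventually_elim
      case (elim n)
      have "(1 - \<delta>) * ln (real k) * (ln (ln (real n) / 2) / \<beta> - 1) = A * ln (ln (real n) / 2) - A * \<beta>"
        using b by (simp add: A_def field_simps)
      then show ?case using elim by simp
    qed
  qed
  show ?thesis
  proof (rule tendstoI)
    fix \<tau> :: real assume \<tau>: "\<tau> > 0"
    have t2: "\<tau> / 2 > 0" using \<tau> by simp
    show "\<forall>\<^sub>F n in sequentially. dist (measure_pmf.prob (poly_pmf n)
        {f :: 'a poly. real (Delta f) \<ge> ln (real n) powr \<eta>}) 1 < \<tau>"
      using prob_many_good_scales[OF k c(1) adm b \<delta>(1) t2 m mle, where 'a='a] large ev0 ev1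
    proof eventually_elim
      case (elim n)
      let ?good = "\<lambda>f j. equal_sums k (irr_degrees (f :: 'a poly) \<inter> scale_interval c \<beta> j)"
      let ?S = "{f. \<delta> * real (m n) \<le> real (card {j\<in>{1..m n}. \<not> ?good f j})}"
      let ?T = "{f :: 'a poly. real (Delta f) \<ge> ln (real n) powr \<eta>}"
      let ?pr = "measure_pmf.prob (poly_pmf n) :: 'a poly set \<Rightarrow> real"
      have sub: "monic_polys n - ?S \<subseteq> ?T"
      proof
        fix f assume f: "f \<in> monic_polys n - ?S"
        then have f0: "f \<noteq> 0" by (auto simp: monic_polys_def)
        let ?G = "{j\<in>{1..m n}. ?good f j}"
        have "card ?G + card {j\<in>{1..m n}. \<not> ?good f j} = card (?G \<union> {j\<in>{1..m n}. \<not> ?good f j})"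
          by (intro card_Un_disjoint[symmetric]) auto
        also have "?G \<union> {j\<in>{1..m n}. \<not> ?good f j} = {1..m n}" by auto
        finally have "real (card ?G) + real (card {j\<in>{1..m n}. \<not> ?good f j}) = real (m n)"
          by (simp flip: of_nat_add)
        then have G: "(1 - \<delta>) * real (m n) \<le> real (card ?G)"
          using f by (simp add: algebra_simps)
        have "ln (ln (real n) / 2) / \<beta> - 1 \<le> real (m n)" using elim(3) unfolding m_def by linarith
        moreover have "(1 - \<delta>) * ln (real k) \<ge> 0" using \<delta>(2) b \<eta>(1) by (smt (verit) mult_pos_pos)
        ultimately have "\<eta> * ln (ln (real n)) \<le> (1 - \<delta>) * ln (real k) * real (m n)"
          using elim(2) by (meson mult_left_mono order_trans)
        also have "\<dots> \<le> real (card ?G) * ln (real k)"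
          using mult_right_mono[OF G, of "ln (real k)"] lnk by (simp add: mult_ac)
        finally have "ln (real n) powr \<eta> \<le> real k powr real (card ?G)"
          using elim(4) k by (simp add: powr_def)
        also have "\<dots> = real (k ^ card ?G)" using k by (simp add: powr_realpow)
        also have "k ^ card ?G \<le> Delta f"
          using k by (intro Delta_ge_power[OF f0 _ _ _ disjoint_scale_intervals[OF b c(1) cb]]) auto
        finally show "f \<in> ?T" by simp
      qed
      have "1 = ?pr (monic_polys n)"
        by (simp add: measure_pmf_of_set finite_monic_polys monic_polys_nonempty card_gt_0_iff)
      also have "\<dots> \<le> ?pr (?S \<union> ?T)"
        using sub by (intro measure_pmf.finite_measure_mono) auto
      also have "\<dots> \<le> ?pr ?S + ?pr ?T"
        by (intro measure_Un_le) auto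
      finally have "1 \<le> ?pr ?S + ?pr ?T" .
      then have "?pr ?T > 1 - \<tau>" using elim(1) \<tau> by linarith
      moreover have "?pr ?T \<le> 1" by simp
      ultimately show ?case by (simp add: dist_real_def)
    qed
  qed
qed

text \<open>A limsup above \<open>\<eta>\<close> gives some \<open>k \<ge> 2\<close> whose quotient
  exceeds \<open>\<eta>\<close>. The target inequality amounts to
  \<open>c > exp (- (ln k / \<eta>))\<close>, a bound lying strictly below the supremum
  \<open>beta k\<close>.\<close>

lemma exists_admissible:
  assumes \<eta>: "\<eta> > 0" "ereal \<eta> < zeta"
  obtains k c where "k \<ge> 2" "0 < c" "c < 1" "admissible k c" "\<eta> * ln (1 / c) < ln (real k)"
proof -
  have "\<not> (\<forall>\<^sub>F k in sequentially. ereal (ln (real k) / ln (1 / beta k)) \<le> ereal \<eta>)"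
    proof
    assume "\<forall>\<^sub>F k in sequentially. ereal (ln (real k) / ln (1 / beta k)) \<le> ereal \<eta>"
    then have "zeta \<le> ereal \<eta>" unfolding zeta_def by (rule Limsup_bounded)
    with \<eta>(2) show False by simp
  qed
  then obtain k where k: "k \<ge> 2" "\<eta> < ln (real k) / ln (1 / beta k)"
    unfolding eventually_sequentially by (auto simp: not_le)
  let ?S = "insert 0 {c. c < 1 \<and> admissible k c}"
  have bdd: "bdd_above ?S" by (intro bdd_aboveI[of _ 1]) auto
  have lnk: "ln (real k) > 0" using k by simp
  have beta0: "beta k \<ge> 0" unfolding beta_def by (intro cSup_upper bdd) auto
  \<comment> \<open>A positive quotient excludes the degenerate values \<open>0\<close> and
    \<open>1\<close> of \<open>beta k\<close>, for which the conventions for \<open>ln 0\<close> and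
    division by \<open>0\<close> make it \<open>0\<close>.\<close>
  have "ln (1 / beta k) > 0"
    using k(2) \<eta>(1) lnk by (smt (verit) divide_le_0_iff)
  then have beta: "beta k > 0" using beta0 by (cases "beta k = 0") auto
  have "\<eta> * ln (1 / beta k) < ln (real k)"
    using k(2) \<open>ln (1 / beta k) > 0\<close> by (simp add: field_simps)
  then have "- (ln (real k) / \<eta>) < ln (beta k)"
    using \<eta> beta by (simp add: ln_div field_simps)
  then have "exp (- (ln (real k) / \<eta>)) < beta k" using beta by (metis exp_less_cancel_iff exp_ln)
  \<comment> \<open>The adjoined element \<open>0\<close> cannot be the witness, because
    \<open>c\<close> exceeds an exponential; hence \<open>c\<close> is admissible.\<close>
  then obtain c where c: "c \<in> ?S" "exp (- (ln (real k) / \<eta>)) < c"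
    using less_cSup_iff[of ?S] bdd unfolding beta_def by auto
  then have c0: "c > 0" using exp_gt_zero order_less_trans by blast
  have "- (ln (real k) / \<eta>) < ln c" using c(2) c0 by (metis exp_less_cancel_iff exp_ln)
  then have "\<eta> * ln (1 / c) < ln (real k)" using c0 \<eta> by (simp add: ln_div field_simps)
  with that[of k c] k c c0 show thesis by auto
qed

text \<open>For \<open>\<eta> \<le> 0\<close> the bound is at most \<open>1\<close> once
  \<open>ln n \<ge> 1\<close>, and the constant divisors already give
  \<open>Delta f \<ge> 1\<close>.\<close>

lemma prob_Delta_tendsto:
  assumes "ereal \<eta> < zeta"
  shows "(\<lambda>n. measure_pmf.prob (poly_pmf n) {f :: 'a::{finite,field} poly. real (Delta f) \<ge> ln (real n) powr \<eta>}) \<longlonglongrightarrow> 1"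
proof (cases "\<eta> > 0")
  case True
  then obtain k c where "k \<ge> 2" "0 < c" "c < 1" "admissible k c" "\<eta> * ln (1 / c) < ln (real k)"
    using exists_admissible[OF True assms] by blast
  then show ?thesis using True by (intro prob_Delta_ge)
next
  case False
  have "\<forall>\<^sub>F n in sequentially. ln (real n) \<ge> 1" by real_asymp
  then have "\<forall>\<^sub>F n in sequentially. measure_pmf.prob (poly_pmf n)
      {f :: 'a poly. real (Delta f) \<ge> ln (real n) powr \<eta>} = 1"
  proof eventually_elim
    case (elim n)
    have "ln (real n) powr \<eta> \<le> ln (real n) powr 0" using False elim by (intro powr_mono) auto
    then have "ln (real n) powr \<eta> \<le> 1" using elim by simp
    have "ln (real n) powr \<eta> \<le> real (Delta f)" if "f \<in> monic_polys n" for f :: "'a poly"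
    proof -
      have "Delta f \<ge> 1" using that by (intro Delta_pos) (auto simp: monic_polys_def)
      then have "real (Delta f) \<ge> 1" by simp
      with \<open>ln (real n) powr \<eta> \<le> 1\<close> show ?thesis by linarith
    qed
    then have "monic_polys n \<inter> {f :: 'a poly. real (Delta f) \<ge> ln (real n) powr \<eta>} = monic_polys n"
      by auto
    then show ?case
      by (simp add: measure_pmf_of_set finite_monic_polys monic_polys_nonempty card_gt_0_iff)
  qed
  then show ?thesis by (simp add: tendsto_eventually)
qed

text \<open>All quotients are nonnegative because \<open>beta k\<close> lies between
  \<open>0\<close> and \<open>1\<close>. This excludes \<open>-\<infinity>\<close>, below which
  there would be no exponents.\<close>

lemma zeta_nonneg: "zeta \<ge> 0"
proof -
  have "ln (real k) / ln (1 / beta k) \<ge> 0" for k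
  proof (cases "k = 0")
    case False
    let ?S = "insert 0 {c. c < 1 \<and> admissible k c}"
    have "bdd_above ?S" by (intro bdd_aboveI[of _ 1]) auto
    then have "beta k \<ge> 0" unfolding beta_def by (intro cSup_upper) auto
    moreover have "beta k \<le> 1" unfolding beta_def by (intro cSup_least) auto
    ultimately have "ln (1 / beta k) \<ge> 0" by (cases "beta k = 0") auto
    then show ?thesis using False by simp
  qed simp
  then have "\<forall>\<^sub>F k in sequentially. (0::ereal) \<le> ereal (ln (real k) / ln (1 / beta k))"
    by simp
  then have "0 \<le> liminf (\<lambda>k. ereal (ln (real k) / ln (1 / beta k)))" by (rule Liminf_bounded)
  also have "\<dots> \<le> zeta" unfolding zeta_def by (rule Liminf_le_Limsup) simp
  finally show ?thesis .
qed

section \<open>Diagonal choice of the exponents\<close>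

lemma ereal_approx_below:
  fixes z :: ereal
  assumes "z \<noteq> -\<infinity>"
  shows "\<exists>x :: nat \<Rightarrow> real. (\<lambda>i. ereal (x i)) \<longlonglongrightarrow> z \<and> (\<forall>i. ereal (x i) < z)"
proof (cases z)
  case (real r)
  have "(\<lambda>i. r - 1 / real (Suc i)) \<longlonglongrightarrow> r" by real_asymp
  then show ?thesis using real by (intro exI[of _ "\<lambda>i. r - 1 / real (Suc i)"]) auto
next
  case PInf
  have "(\<lambda>i. ereal (real i)) \<longlonglongrightarrow> \<infinity>" by (rule id_nat_ereal_tendsto_PInf)
  then show ?thesis using PInf by (intro exI[of _ real]) auto
qed (use assms in auto)

text \<open>At \<open>n\<close> use the approximant \<open>x i\<close> with the largest
  \<open>i \<le> n\<close> for which \<open>F n (x i)\<close> is within \<open>1 / (i + 1)\<close>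
  of \<open>1\<close>. Each \<open>i\<close> eventually qualifies, so the chosen index tends to
  infinity and both limits follow.\<close>

lemma diagonal_limit:
  fixes F :: "nat \<Rightarrow> real \<Rightarrow> real"
  assumes "z \<noteq> -\<infinity>" and F: "\<And>\<eta>. ereal \<eta> < z \<Longrightarrow> (\<lambda>n. F n \<eta>) \<longlonglongrightarrow> 1"
  shows "\<exists>e. (\<lambda>n. ereal (e n)) \<longlonglongrightarrow> z \<and> (\<lambda>n. F n (e n)) \<longlonglongrightarrow> 1"
proof -
  obtain x where x: "(\<lambda>i. ereal (x i)) \<longlonglongrightarrow> z" "\<And>i. ereal (x i) < z"
    using ereal_approx_below[OF assms(1)] by blast
  define Q where "Q i n \<longleftrightarrow> (i :: nat) \<le> n \<and> \<bar>F n (x i) - 1\<bar> \<le> 1 / real (Suc i)" for i n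
  have ev: "\<forall>\<^sub>F n in sequentially. Q i n" for i
  proof -
    have "\<forall>\<^sub>F n in sequentially. dist (F n (x i)) 1 < 1 / real (Suc i)"
      using F[OF x(2)] by (intro tendstoD) auto
    then show ?thesis using eventually_ge_at_top[of i]
      by eventually_elim (simp add: Q_def dist_real_def)
  qed
  \<comment> \<open>The condition \<open>i \<le> n\<close> in \<open>Q\<close> makes the maximum
    finite. The adjoined \<open>0\<close> keeps the set nonempty for small \<open>n\<close>;
    eventually \<open>Q 0 n\<close> holds, so the maximum itself satisfies \<open>Q\<close>.\<close>
  define s where "s n = Max (insert 0 {i. Q i n})" for n
  have fin: "finite {i. Q i n}" for n
    by (rule finite_subset[of _ "{..n}"]) (auto simp: Q_def)
  have ge: "s n \<ge> i" if "Q i n" for i n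
    unfolding s_def using fin that by (intro Max_ge) auto
  have s: "filterlim s at_top sequentially"
    unfolding filterlim_at_top
  proof
    show "\<forall>\<^sub>F n in sequentially. Z \<le> s n" for Z
      using ev[of Z] by (rule eventually_mono) (rule ge)
  qed
  have Qs: "\<forall>\<^sub>F n in sequentially. Q (s n) n"
    using ev[of 0]
  proof eventually_elim
    case (elim n)
    have "s n \<in> insert 0 {i. Q i n}" unfolding s_def using fin by (intro Max_in) auto
    then show ?case using elim by auto
  qed
  have "(\<lambda>n. ereal (x (s n))) \<longlonglongrightarrow> z" by (rule filterlim_compose[OF x(1) s])
  moreover have "(\<lambda>n. F n (x (s n)) - 1) \<longlonglongrightarrow> 0"
  proof (rule Lim_null_comparison)
    show "\<forall>\<^sub>F n in sequentially. norm (F n (x (s n)) - 1) \<le> 1 / real (Suc (s n))"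
      using Qs by eventually_elim (simp add: Q_def)
    have "(\<lambda>i. 1 / real (Suc i)) \<longlonglongrightarrow> 0" by real_asymp
    then show "(\<lambda>n. 1 / real (Suc (s n))) \<longlonglongrightarrow> 0" by (rule filterlim_compose[OF _ s])
  qed
  ultimately show ?thesis by (intro exI[of _ "\<lambda>n. x (s n)"]) (simp add: LIM_zero_iff)
qed

text \<open>The exponent \<open>zeta - o(1)\<close> is expressed as a real sequence \<open>e\<close>
  converging to \<open>zeta\<close> in the extended reals, which also makes sense for infinite
  \<open>zeta\<close>.\<close>

theorem theorem5:
  shows "\<exists>e :: nat \<Rightarrow> real.
    (\<lambda>n. ereal (e n)) \<longlonglongrightarrow> zeta \<and>
    (\<lambda>n. measure_pmf.prob (pmf_of_set (monic_polys n :: 'a::{finite,field} poly set))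
       {f. real (Delta f) \<ge> ln (real n) powr e n}) \<longlonglongrightarrow> 1"
proof (rule diagonal_limit)
  show "zeta \<noteq> -\<infinity>" using zeta_nonneg by auto
qed (rule prob_Delta_tendsto)

end
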